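(* Let $(M,h,\nabla)$ be a quasi-statistical manifold with $h$ symmetric or skew-symmetric. Let $\hat h$ and $\hat\nabla$ be the induced generalized quasi-statistical structure on $TM\oplus T^*M$ and $\hat\nabla^*$ the dual connection of $\hat\nabla$ with respect to $\hat h$. Then $\hat\nabla^*$ is torsion-free, i.e. for all $\sigma,\tau\in C^\infty(TM\oplus T^*M)$ $$T^{\hat\nabla^*}(\sigma,\tau):=\hat\nabla^*_\sigma\tau-\hat\nabla^*_\tau\sigma-[\sigma,\tau]_\nabla=0 .$$
   Context: $\nabla$ is an affine connection on the smooth manifold $M$, possibly with torsion $T^\nabla(X,Y)=\nabla_XY-\nabla_YX-[X,Y]$, acting on 1-forms by $(\nabla_X\beta)(Y)=X(\beta(Y))-\beta(\nabla_XY)$. $h$ is a non-degenerate $(0,2)$-tensor field; $h$ also denotes the isomorphism $TM\to T^*M$, $h(X)=h(X,\cdot)$, with inverse $h^{-1}$. $(M,h,\nabla)$ is a quasi-statistical manifold if $(\nabla_Xh)(Y,Z)-(\nabla_Yh)(X,Z)+h(T^\nabla(X,Y),Z)=0$ for all $X,Y,Z$. On $TM\oplus T^*M$: $[X+\alpha,Y+\beta]_\nabla=[X,Y]+\nabla_X\beta-\nabla_Y\alpha$; $\hat h(X+\alpha,Y+\beta)=-\frac12(\alpha(Y)+\beta(X))$ if $h$ is symmetric, $\hat h(X+\alpha,Y+\beta)=-\frac12(\alpha(Y)-\beta(X))$ if $h$ is skew-symmetric; $\hat\nabla_{X+\alpha}(Y+\beta)=\nabla_XY+h(\nabla_X(h^{-1}(\beta)))$;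 and $\hat\nabla^*$ is defined by $\hat h(\tau,\hat\nabla^*_{X+\alpha}\nu)=X(\hat h(\tau,\nu))-\hat h(\hat\nabla_{X+\alpha}\tau,\nu)$ for all $\tau,\nu\in C^\infty(TM\oplus T^*M)$. *)

theory Defs
  imports "HOL-Analysis.Analysis" "HOL-Library.Function_Algebras"
begin

section \<open>Smooth manifolds\<close>

text \<open>
  On an open set \<open>S\<close> of a Euclidean space, \<open>Ck_on k S f\<close> says that \<open>f\<close> is of class \<open>C\<^sup>k\<close>.
\<close>

primrec Ck_on ::
  "nat \<Rightarrow> 'e::euclidean_space set \<Rightarrow> ('e \<Rightarrow> 'b::real_normed_vector) \<Rightarrow> bool" where
  "Ck_on 0 S f \<longleftrightarrow> continuous_on S f"
| "Ck_on (Suc k) S f \<longleftrightarrow> (\<forall>x\<in>S. f differentiable (at x)) \<and>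
     (\<forall>v. Ck_on k S (\<lambda>x. frechet_derivative f (at x) v))"

definition smooth_on :: "'e::euclidean_space set \<Rightarrow> ('e \<Rightarrow> 'b::real_normed_vector) \<Rightarrow> bool" where
  "smooth_on S f \<longleftrightarrow> (\<forall>k. Ck_on k S f)"

text \<open>
  A chart is a pair of its domain and its coordinate map; only the values of the coordinate map on
  the domain matter. The smooth structure is given by an atlas, not necessarily a maximal one.
\<close>

record ('a, 'e) manifold =
  mtop :: "'a topology"
  atlas :: "('a set \<times> ('a \<Rightarrow> 'e)) set"

abbreviation points :: "('a, 'e, 'z) manifold_scheme \<Rightarrow> 'a set" where
  "points M \<equiv> topspace (mtop M)"

definition smooth_manifold :: "('a, 'e::euclidean_space) manifold \<Rightarrow> bool" where
  "smooth_manifold M \<longleftrightarrow>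
     Hausdorff_space (mtop M) \<and> second_countable (mtop M) \<and>
     (\<Union>(U, \<phi>)\<in>atlas M. U) = points M \<and>
     (\<forall>(U, \<phi>)\<in>atlas M. openin (mtop M) U \<and> open (\<phi> ` U) \<and>
        homeomorphic_map (subtopology (mtop M) U) (top_of_set (\<phi> ` U)) \<phi>) \<and>
     (\<forall>(U, \<phi>)\<in>atlas M. \<forall>(V, \<psi>)\<in>atlas M. smooth_on (\<phi> ` (U \<inter> V)) (\<psi> \<circ> inv_into U \<phi>))"

text \<open>
  Functions on \<open>M\<close> are functions on the ambient type whose values outside \<open>points M\<close> are arbitrary.
\<close>

definition smooth_functions :: "('a, 'e::euclidean_space) manifold \<Rightarrow> ('a \<Rightarrow> real) set" where
  "smooth_functions M = {f. \<forall>(U, \<phi>)\<in>atlas M. smooth_on (\<phi> ` U) (f \<circ> inv_into U \<phi>)}"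

section \<open>Vector fields and tensor fields\<close>

text \<open>
  Tangent vectors at \<open>p\<close> are the derivations at \<open>p\<close> of the algebra of smooth functions, and covectors
  are linear functionals on the tangent space. Sums, products and \<open>0\<close> of functions are pointwise.
  So that equality of HOL functions is equality of the geometric objects, everything is extended
  by \<open>0\<close>: tangent vectors vanish on non-smooth functions, covectors and bilinear forms vanish off
  the tangent space, and fields vanish outside \<open>points M\<close>. A derivation cannot see the values of a
  function outside \<open>points M\<close>: if \<open>f\<close> vanishes on \<open>points M\<close>, then \<open>f = f * k\<close> for the indicator
  function \<open>k\<close> of the complement, so the product rule gives \<open>v f = 0\<close>.
\<close>

type_synonym 'a tvec = "('a \<Rightarrow> real) \<Rightarrow> real"
type_synonym 'a vfield = "'a \<Rightarrow> 'a tvec"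
type_synonym 'a form = "'a \<Rightarrow> 'a tvec \<Rightarrow> real"
type_synonym 'a tensor2 = "'a \<Rightarrow> 'a tvec \<Rightarrow> 'a tvec \<Rightarrow> real"

definition tscale :: "real \<Rightarrow> 'a tvec \<Rightarrow> 'a tvec" where
  "tscale c v = (\<lambda>f. c * v f)"

definition tangent_space :: "('a, 'e::euclidean_space) manifold \<Rightarrow> 'a \<Rightarrow> 'a tvec set" where
  "tangent_space M p = {v.
     (\<forall>f\<in>smooth_functions M. \<forall>g\<in>smooth_functions M. v (f + g) = v f + v g) \<and>
     (\<forall>c. \<forall>f\<in>smooth_functions M. v (\<lambda>x. c * f x) = c * v f) \<and>
     (\<forall>f\<in>smooth_functions M. \<forall>g\<in>smooth_functions M. v (f * g) = f p * v g + g p * v f) \<and>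
     (\<forall>f. f \<notin> smooth_functions M \<longrightarrow> v f = 0)}"

definition cotangent_space ::
  "('a, 'e::euclidean_space) manifold \<Rightarrow> 'a \<Rightarrow> ('a tvec \<Rightarrow> real) set" where
  "cotangent_space M p = {\<omega>.
     (\<forall>v\<in>tangent_space M p. \<forall>w\<in>tangent_space M p. \<omega> (v + w) = \<omega> v + \<omega> w) \<and>
     (\<forall>c. \<forall>v\<in>tangent_space M p. \<omega> (tscale c v) = c * \<omega> v) \<and>
     (\<forall>v. v \<notin> tangent_space M p \<longrightarrow> \<omega> v = 0)}"

definition vapply :: "'a vfield \<Rightarrow> ('a \<Rightarrow> real) \<Rightarrow> 'a \<Rightarrow> real" where
  "vapply X f = (\<lambda>p. X p f)"

definition fapply :: "'a form \<Rightarrow> 'a vfield \<Rightarrow> 'a \<Rightarrow> real" where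
  "fapply \<alpha> X = (\<lambda>p. \<alpha> p (X p))"

definition tapply :: "'a tensor2 \<Rightarrow> 'a vfield \<Rightarrow> 'a vfield \<Rightarrow> 'a \<Rightarrow> real" where
  "tapply h X Y = (\<lambda>p. h p (X p) (Y p))"

definition vector_fields :: "('a, 'e::euclidean_space) manifold \<Rightarrow> 'a vfield set" where
  "vector_fields M = {X.
     (\<forall>p\<in>points M. X p \<in> tangent_space M p) \<and> (\<forall>p. p \<notin> points M \<longrightarrow> X p = 0) \<and>
     (\<forall>f\<in>smooth_functions M. vapply X f \<in> smooth_functions M)}"

definition one_forms :: "('a, 'e::euclidean_space) manifold \<Rightarrow> 'a form set" where
  "one_forms M = {\<alpha>.
     (\<forall>p\<in>points M. \<alpha> p \<in> cotangent_space M p) \<and> (\<forall>p. p \<notin> points M \<longrightarrow> \<alpha> p = 0) \<and>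
     (\<forall>X\<in>vector_fields M. fapply \<alpha> X \<in> smooth_functions M)}"

text \<open>The first condition below says that \<open>h p\<close> is bilinear on the tangent space at \<open>p\<close>.\<close>

definition tensor_fields2 :: "('a, 'e::euclidean_space) manifold \<Rightarrow> 'a tensor2 set" where
  "tensor_fields2 M = {h.
     (\<forall>p\<in>points M. \<forall>v\<in>tangent_space M p.
        h p v \<in> cotangent_space M p \<and> (\<lambda>w. h p w v) \<in> cotangent_space M p) \<and>
     (\<forall>p v w. p \<notin> points M \<or> v \<notin> tangent_space M p \<or> w \<notin> tangent_space M p \<longrightarrow> h p v w = 0) \<and>
     (\<forall>X\<in>vector_fields M. \<forall>Y\<in>vector_fields M. tapply h X Y \<in> smooth_functions M)}"

definition nondegenerate :: "('a, 'e::euclidean_space) manifold \<Rightarrow> 'a tensor2 \<Rightarrow> bool" where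
  "nondegenerate M h \<longleftrightarrow>
     (\<forall>p\<in>points M. \<forall>v\<in>tangent_space M p. (\<forall>w\<in>tangent_space M p. h p v w = 0) \<longrightarrow> v = 0)"

definition symmetric_tensor :: "('a, 'e::euclidean_space) manifold \<Rightarrow> 'a tensor2 \<Rightarrow> bool" where
  "symmetric_tensor M h \<longleftrightarrow>
     (\<forall>p\<in>points M. \<forall>v\<in>tangent_space M p. \<forall>w\<in>tangent_space M p. h p v w = h p w v)"

definition skew_tensor :: "('a, 'e::euclidean_space) manifold \<Rightarrow> 'a tensor2 \<Rightarrow> bool" where
  "skew_tensor M h \<longleftrightarrow>
     (\<forall>p\<in>points M. \<forall>v\<in>tangent_space M p. \<forall>w\<in>tangent_space M p. h p v w = - h p w v)"

text \<open>
  \<open>flat h\<close> and \<open>sharp M h\<close> are the bundle isomorphism \<open>h\<close> and its inverse acting on sections. By the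
  conventions above, \<open>h p\<close> itself is the map from the tangent to the cotangent space at \<open>p\<close>, and it
  is bijective for non-degenerate \<open>h\<close>.
\<close>

definition flat :: "'a tensor2 \<Rightarrow> 'a vfield \<Rightarrow> 'a form" where
  "flat h X = (\<lambda>p. h p (X p))"

definition sharp :: "('a, 'e::euclidean_space) manifold \<Rightarrow> 'a tensor2 \<Rightarrow> 'a form \<Rightarrow> 'a vfield" where
  "sharp M h \<beta> = (\<lambda>p. if p \<in> points M then inv_into (tangent_space M p) (h p) (\<beta> p) else 0)"

section \<open>Affine connections and quasi-statistical manifolds\<close>

definition vscale :: "('a \<Rightarrow> real) \<Rightarrow> 'a vfield \<Rightarrow> 'a vfield" where
  "vscale f X = (\<lambda>p. tscale (f p) (X p))"

definition lie_bracket :: "'a vfield \<Rightarrow> 'a vfield \<Rightarrow> 'a vfield" where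
  "lie_bracket X Y = (\<lambda>p f. X p (vapply Y f) - Y p (vapply X f))"

type_synonym 'a connection = "'a vfield \<Rightarrow> 'a vfield \<Rightarrow> 'a vfield"

definition affine_connection ::
  "('a, 'e::euclidean_space) manifold \<Rightarrow> 'a connection \<Rightarrow> bool" where
  "affine_connection M D \<longleftrightarrow>
     (\<forall>X\<in>vector_fields M. \<forall>Y\<in>vector_fields M. D X Y \<in> vector_fields M) \<and>
     (\<forall>X\<in>vector_fields M. \<forall>Y\<in>vector_fields M. \<forall>Z\<in>vector_fields M.
        D (X + Y) Z = D X Z + D Y Z \<and> D X (Y + Z) = D X Y + D X Z) \<and>
     (\<forall>f\<in>smooth_functions M. \<forall>X\<in>vector_fields M. \<forall>Y\<in>vector_fields M.
        D (vscale f X) Y = vscale f (D X Y) \<and>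
        D X (vscale f Y) = vscale f (D X Y) + vscale (vapply X f) Y)"

definition torsion :: "'a connection \<Rightarrow> 'a vfield \<Rightarrow> 'a vfield \<Rightarrow> 'a vfield" where
  "torsion D X Y = D X Y - D Y X - lie_bracket X Y"

definition cov_form ::
  "('a, 'e::euclidean_space) manifold \<Rightarrow> 'a connection \<Rightarrow> 'a vfield \<Rightarrow> 'a form \<Rightarrow> 'a form" where
  "cov_form M D X \<beta> = (THE \<gamma>. \<gamma> \<in> one_forms M \<and>
     (\<forall>Y\<in>vector_fields M. fapply \<gamma> Y = vapply X (fapply \<beta> Y) - fapply \<beta> (D X Y)))"

text \<open>\<open>cov_tensor D X h Y Z\<close> is the function \<open>(\<nabla>\<^sub>X h)(Y, Z)\<close>.\<close>

definition cov_tensor ::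
  "'a connection \<Rightarrow> 'a vfield \<Rightarrow> 'a tensor2 \<Rightarrow> 'a vfield \<Rightarrow> 'a vfield \<Rightarrow> 'a \<Rightarrow> real" where
  "cov_tensor D X h Y Z = vapply X (tapply h Y Z) - tapply h (D X Y) Z - tapply h Y (D X Z)"

definition quasi_statistical ::
  "('a, 'e::euclidean_space) manifold \<Rightarrow> 'a tensor2 \<Rightarrow> 'a connection \<Rightarrow> bool" where
  "quasi_statistical M h D \<longleftrightarrow>
     affine_connection M D \<and> h \<in> tensor_fields2 M \<and> nondegenerate M h \<and>
     (\<forall>X\<in>vector_fields M. \<forall>Y\<in>vector_fields M. \<forall>Z\<in>vector_fields M.
        cov_tensor D X h Y Z - cov_tensor D Y h X Z + tapply h (torsion D X Y) Z = 0)"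

section \<open>The generalized tangent bundle\<close>

text \<open>A section \<open>X + \<alpha>\<close> of the generalized tangent bundle is the pair \<open>(X, \<alpha>)\<close>.\<close>

type_synonym 'a gsection = "'a vfield \<times> 'a form"
type_synonym 'a gconnection = "'a gsection \<Rightarrow> 'a gsection \<Rightarrow> 'a gsection"

definition gsections :: "('a, 'e::euclidean_space) manifold \<Rightarrow> 'a gsection set" where
  "gsections M = vector_fields M \<times> one_forms M"

definition gbracket ::
  "('a, 'e::euclidean_space) manifold \<Rightarrow> 'a connection \<Rightarrow> 'a gsection \<Rightarrow> 'a gsection \<Rightarrow> 'a gsection" where
  "gbracket M D = (\<lambda>(X, \<alpha>) (Y, \<beta>). (lie_bracket X Y, cov_form M D X \<beta> - cov_form M D Y \<alpha>))"

text \<open>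
  Used only for symmetric or skew-symmetric \<open>h\<close>. A non-degenerate \<open>h\<close> on a non-empty \<open>M\<close> cannot be
  both, as the model space has positive dimension.
\<close>

definition hhat ::
  "('a, 'e::euclidean_space) manifold \<Rightarrow> 'a tensor2 \<Rightarrow> 'a gsection \<Rightarrow> 'a gsection \<Rightarrow> 'a \<Rightarrow> real" where
  "hhat M h = (\<lambda>(X, \<alpha>) (Y, \<beta>) p.
     if symmetric_tensor M h then - (1 / 2) * (fapply \<alpha> Y p + fapply \<beta> X p)
     else - (1 / 2) * (fapply \<alpha> Y p - fapply \<beta> X p))"

definition Dhat ::
  "('a, 'e::euclidean_space) manifold \<Rightarrow> 'a tensor2 \<Rightarrow> 'a connection \<Rightarrow> 'a gconnection" where
  "Dhat M h D = (\<lambda>(X, \<alpha>) (Y, \<beta>). (D X Y, flat h (D X (sharp M h \<beta>))))"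

definition dual_gconnection ::
  "('a, 'e::euclidean_space) manifold \<Rightarrow> ('a gsection \<Rightarrow> 'a gsection \<Rightarrow> 'a \<Rightarrow> real) \<Rightarrow>
     'a gconnection \<Rightarrow> 'a gconnection" where
  "dual_gconnection M H N \<sigma> \<nu> = (THE \<mu>. \<mu> \<in> gsections M \<and>
     (\<forall>\<tau>\<in>gsections M. H \<tau> \<mu> = vapply (fst \<sigma>) (H \<tau> \<nu>) - H (N \<sigma> \<tau>) \<nu>))"

definition gtorsion ::
  "('a, 'e::euclidean_space) manifold \<Rightarrow> 'a connection \<Rightarrow> 'a gconnection \<Rightarrow>
     'a gsection \<Rightarrow> 'a gsection \<Rightarrow> 'a gsection" where
  "gtorsion M D N \<sigma> \<tau> = N \<sigma> \<tau> - N \<tau> \<sigma> - gbracket M D \<sigma> \<tau>"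

end

theory Submission
  imports Defs
begin

text \<open>
  Let \<open>s\<close> be the sign with \<open>h(v, w) = s h(w, v)\<close>. Unwinding the definition, the dual connection is
  \<open>(X + \<alpha>, Y + \<beta>) \<mapsto> h\<^sup>-\<^sup>1(\<nabla>\<^sub>X (h Y)) + \<nabla>\<^sub>X \<beta>\<close>; the sign cancels. The form part of the torsion then cancels
  against the bracket, and pairing the vector part with \<open>Z\<close> gives
  \<open>(\<nabla>\<^sub>X h)(Y, Z) - (\<nabla>\<^sub>Y h)(X, Z) + h(T(X, Y), Z)\<close>, which vanishes on a quasi-statistical manifold.
  The analytic content is that the objects in this formula exist: a \<open>C\<^sup>\<infinity>\<close>-linear functional on vector
  fields is a smooth 1-form, and \<open>h\<^sup>-\<^sup>1\<close> of a smooth 1-form is a smooth vector field. Both follow from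
  local frames, obtained from bump functions and Hadamard's lemma.
\<close>

section \<open>Calculus of \<open>C\<^sup>k\<close> functions\<close>

text \<open>\<open>cov_form\<close> and \<open>dual_gconnection\<close> are definite descriptions,
  so each needs an existence and a uniqueness proof before anything can be computed with it.
  Uniqueness requires enough global test fields: every single tangent vector has to extend to a
  smooth vector field on all of M. Tangent vectors are derivations of the algebra of global smooth
  functions, so coordinates and coordinate fields must be cut off and extended by 0 before a tangent
  vector can act on them. Infinite differentiability is essential here: the factors in Hadamard's
  lemma lose one derivative, so in class C^k with finite k they would leave the algebra and a
  derivation would no longer be determined by its values on the coordinates. \<open>sharp\<close> is
  a pointwise choice of preimage, which says nothing about dependence on the point; smoothness comes
  from identifying it with an explicit local solution. The sign s cancels because every term of the
  equation that defines the dual connection carries it exactly once, as soon as h(V, Z) is rewritten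
  as s h(Z, V).\<close>

lemma Ck_on_cong:
  assumes "open S" "\<And>x. x \<in> S \<Longrightarrow> f x = g x" "Ck_on k S f"
  shows "Ck_on k S g"
  using assms(2,3)
proof (induction k arbitrary: f g)
  case 0
  then show ?case by (auto cong: continuous_on_cong)
next
  case (Suc k)
  have *: "(g has_derivative frechet_derivative f (at x)) (at x)" if "x \<in> S" for x
    using Suc.prems that assms(1)
    by (intro has_derivative_transform_within_open[of f _ x UNIV S g])
       (auto simp: frechet_derivative_works)
  have "Ck_on k S (\<lambda>x. frechet_derivative g (at x) v)" for v
  proof (rule Suc.IH)
    show "frechet_derivative f (at x) v = frechet_derivative g (at x) v" if "x \<in> S" for x
      using frechet_derivative_at[OF *[OF that]] by simp
    show "Ck_on k S (\<lambda>x. frechet_derivative f (at x) v)"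
      using Suc.prems by simp
  qed
  with * show ?case
    by (auto simp: differentiable_def)
qed

text \<open>Replaces \<open>frechet_derivative\<close>, which is defined by choice, by an explicit
  candidate \<open>f'\<close> given by a differentiation rule. The closure proofs below are
  inductions on k that use it in the step; they generalise over the functions because the induction
  hypothesis is applied to directional derivatives.\<close>

lemma Ck_on_SucI:
  assumes "open S" "\<And>x. x \<in> S \<Longrightarrow> (f has_derivative f' x) (at x)"
    and "\<And>v. Ck_on k S (\<lambda>x. f' x v)"
  shows "Ck_on (Suc k) S f"
  unfolding Ck_on.simps
proof (intro conjI ballI allI)
  show "f differentiable at x" if "x \<in> S" for x
    using assms(2)[OF that] by (auto simp: differentiable_def)
  show "Ck_on k S (\<lambda>x. frechet_derivative f (at x) v)" for v
    by (rule Ck_on_cong[OF assms(1) _ assms(3)])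
       (simp add: frechet_derivative_at[OF assms(2), symmetric])
qed

lemma Ck_on_Suc_has_derivative:
  "Ck_on (Suc k) S f \<Longrightarrow> x \<in> S \<Longrightarrow> (f has_derivative frechet_derivative f (at x)) (at x)"
  by (simp add: frechet_derivative_works)

lemma Ck_on_Suc_imp: "Ck_on (Suc k) S f \<Longrightarrow> Ck_on k S f"
proof (induction k arbitrary: f)
  case 0
  then show ?case
    by (auto intro!: differentiable_imp_continuous_on differentiable_at_imp_differentiable_on)
next
  case (Suc k)
  have "Ck_on k S (\<lambda>x. frechet_derivative f (at x) v)" for v
    using Suc.prems by (intro Suc.IH) (simp only: Ck_on.simps(2)[of "Suc k"])
  with Suc.prems show ?case by simp
qed

lemma Ck_on_subset: "Ck_on k S f \<Longrightarrow> T \<subseteq> S \<Longrightarrow> Ck_on k T f"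
  by (induction k arbitrary: f) (auto intro: continuous_on_subset)

lemma Ck_on_local:
  assumes "\<And>x. x \<in> S \<Longrightarrow> \<exists>T. open T \<and> x \<in> T \<and> Ck_on k T f"
  shows "Ck_on k S f"
  using assms
proof (induction k arbitrary: f)
  case 0
  have "continuous (at x) f" if "x \<in> S" for x
    using 0[OF that] by (auto simp: continuous_on_eq_continuous_at)
  then show ?case
    by (simp add: continuous_at_imp_continuous_on)
next
  case (Suc k)
  show ?case
    unfolding Ck_on.simps
  proof (intro conjI ballI allI)
    show "f differentiable at x" if "x \<in> S" for x
      using Suc.prems[OF that] by auto
    show "Ck_on k S (\<lambda>x. frechet_derivative f (at x) v)" for v
    proof (rule Suc.IH)
      fix x assume "x \<in> S"
      from Suc.prems[OF this] show "\<exists>T. open T \<and> x \<in> T \<and> Ck_on k T (\<lambda>x. frechet_derivative f (at x) v)"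
        by auto
    qed
  qed
qed

lemma Ck_on_const: "Ck_on k S (\<lambda>x. c)"
  by (induction k arbitrary: c) (auto simp: frechet_derivative_const)

lemma Ck_on_add:
  assumes "open S" "Ck_on k S f" "Ck_on k S g"
  shows "Ck_on k S (\<lambda>x. f x + g x)"
  using assms(2,3)
proof (induction k arbitrary: f g)
  case 0
  then show ?case by (auto intro: continuous_on_add)
next
  case (Suc k)
  show ?case
  proof (rule Ck_on_SucI[OF assms(1)])
    show "((\<lambda>x. f x + g x) has_derivative
       (\<lambda>v. frechet_derivative f (at x) v + frechet_derivative g (at x) v)) (at x)" if "x \<in> S" for x
      using that Suc.prems by (intro has_derivative_add Ck_on_Suc_has_derivative)
    show "Ck_on k S (\<lambda>x. frechet_derivative f (at x) v + frechet_derivative g (at x) v)" for v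
      by (rule Suc.IH) (use Suc.prems in simp_all)
  qed
qed

lemma Ck_on_bounded_linear:
  assumes "bounded_linear L" "open S" "Ck_on k S f"
  shows "Ck_on k S (\<lambda>x. L (f x))"
  using assms(3)
proof (induction k arbitrary: f)
  case 0
  then show ?case using assms(1) by (auto intro: bounded_linear.continuous_on)
next
  case (Suc k)
  show ?case
  proof (rule Ck_on_SucI[OF assms(2)])
    show "((\<lambda>x. L (f x)) has_derivative (\<lambda>v. L (frechet_derivative f (at x) v))) (at x)" if "x \<in> S" for x
      using that Suc.prems by (intro bounded_linear.has_derivative[OF assms(1)] Ck_on_Suc_has_derivative)
    show "Ck_on k S (\<lambda>x. L (frechet_derivative f (at x) v))" for v
      by (rule Suc.IH) (use Suc.prems in simp)
  qed
qed

lemma Ck_on_scaleR: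
  fixes g :: "'e::euclidean_space \<Rightarrow> 'b::real_normed_vector"
  assumes "open S" "Ck_on k S f" "Ck_on k S g"
  shows "Ck_on k S (\<lambda>x. f x *\<^sub>R g x)"
  using assms(2,3)
proof (induction k arbitrary: f g)
  case 0
  then show ?case by (auto intro: continuous_on_scaleR)
next
  case (Suc k)
  show ?case
  proof (rule Ck_on_SucI[OF assms(1)])
    show "((\<lambda>x. f x *\<^sub>R g x) has_derivative
       (\<lambda>v. f x *\<^sub>R frechet_derivative g (at x) v + frechet_derivative f (at x) v *\<^sub>R g x)) (at x)"
      if "x \<in> S" for x
      using that Suc.prems by (intro has_derivative_scaleR Ck_on_Suc_has_derivative)
    show "Ck_on k S (\<lambda>x. f x *\<^sub>R frechet_derivative g (at x) v + frechet_derivative f (at x) v *\<^sub>R g x)" for v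
    proof (intro Ck_on_add assms(1) Suc.IH)
      \<comment> \<open>Each summand of the product rule keeps one factor undifferentiated, so that
        factor must be lowered from C^(k+1) to C^k before the induction hypothesis applies.\<close>
      show "Ck_on k S f" "Ck_on k S g"
        using Suc.prems by (auto intro: Ck_on_Suc_imp simp del: Ck_on.simps)
    qed (use Suc.prems in simp_all)
  qed
qed

lemma Ck_on_mult:
  fixes f g :: "'e::euclidean_space \<Rightarrow> real"
  assumes "open S" "Ck_on k S f" "Ck_on k S g"
  shows "Ck_on k S (\<lambda>x. f x * g x)"
  using Ck_on_scaleR[OF assms] by simp

lemma Ck_on_sum:
  assumes "open S" "\<And>i. i \<in> I \<Longrightarrow> Ck_on k S (f i)"
  shows "Ck_on k S (\<lambda>x. \<Sum>i\<in>I. f i x)"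
  using assms(2)
  by (induction I rule: infinite_finite_induct) (auto intro: Ck_on_const Ck_on_add assms(1))

text \<open>The chain rule differentiates g in a direction that itself varies with x, whereas
  \<open>Ck_on\<close> speaks of fixed directions only. Expanding the direction in the standard
  basis leaves a finite sum of products, each with a fixed-direction derivative of g composed with
  f, to which the induction hypothesis applies.\<close>

lemma Ck_on_compose:
  fixes f :: "'d::euclidean_space \<Rightarrow> 'e::euclidean_space" and g :: "'e \<Rightarrow> 'b::real_normed_vector"
  assumes "open S" "open T" "f ` S \<subseteq> T" "Ck_on k S f" "Ck_on k T g"
  shows "Ck_on k S (\<lambda>x. g (f x))"
  using assms(4,5)
proof (induction k arbitrary: g)
  case 0
  then show ?case using assms(3) by (auto intro: continuous_on_compose2)
next
  case (Suc k)
  show ?case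
  proof (rule Ck_on_SucI[OF assms(1)])
    fix x assume x: "x \<in> S"
    have g: "(g has_derivative frechet_derivative g (at (f x))) (at (f x))"
      using x assms(3) Suc.prems by (intro Ck_on_Suc_has_derivative) auto
    then have lin: "linear (frechet_derivative g (at (f x)))"
      by (rule has_derivative_linear)
    have "((\<lambda>x. g (f x)) has_derivative (\<lambda>v. frechet_derivative g (at (f x)) (frechet_derivative f (at x) v))) (at x)"
      using has_derivative_compose[OF Ck_on_Suc_has_derivative[OF Suc.prems(1) x] g] .
    moreover have "frechet_derivative g (at (f x)) (frechet_derivative f (at x) v) = (\<Sum>b\<in>Basis. (frechet_derivative f (at x) v \<bullet> b) *\<^sub>R frechet_derivative g (at (f x)) b)" for v
      by (subst euclidean_representation[of "frechet_derivative f (at x) v", symmetric])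
         (simp add: linear_sum[OF lin] linear_cmul[OF lin] del: euclidean_representation)
    ultimately show "((\<lambda>x. g (f x)) has_derivative
       (\<lambda>v. \<Sum>b\<in>Basis. (frechet_derivative f (at x) v \<bullet> b) *\<^sub>R frechet_derivative g (at (f x)) b)) (at x)"
      by simp
  next
    show "Ck_on k S (\<lambda>x. \<Sum>b\<in>Basis. (frechet_derivative f (at x) v \<bullet> b) *\<^sub>R frechet_derivative g (at (f x)) b)" for v
    proof (intro Ck_on_sum Ck_on_scaleR assms(1) Suc.IH Ck_on_bounded_linear[OF bounded_linear_inner_left])
      show "Ck_on k S f"
        by (rule Ck_on_Suc_imp[OF Suc.prems(1)])
    qed (use Suc.prems in simp_all)
  qed
qed

lemma Ck_on_inverse: "Ck_on k (- {0::real}) inverse"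
proof (induction k)
  case 0
  then show ?case by (auto intro!: continuous_intros)
next
  case (Suc k)
  have "open (- {0::real})"
    by (simp add: open_Compl)
  then show ?case
  proof (rule Ck_on_SucI)
    show "(inverse has_derivative (\<lambda>v. - (inverse x * v * inverse x))) (at x)" if "x \<in> - {0}" for x :: real
      using that by (intro has_derivative_inverse') simp
    show "Ck_on k (- {0}) (\<lambda>x. - (inverse x * v * inverse x))" for v :: real
      by (intro Ck_on_bounded_linear[OF bounded_linear_minus[OF bounded_linear_ident]]
          Ck_on_mult Ck_on_const Suc.IH \<open>open _\<close>)
  qed
qed

section \<open>Closure rules for smooth functions on Euclidean sets\<close>

lemma smooth_on_const: "smooth_on S (\<lambda>x. c)"
  by (simp add: smooth_on_def Ck_on_const)

lemma smooth_on_bounded_linear: "bounded_linear L \<Longrightarrow> open S \<Longrightarrow> smooth_on S f \<Longrightarrow> smooth_on S (\<lambda>x. L (f x))"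
  by (simp add: smooth_on_def Ck_on_bounded_linear)

lemma smooth_on_id: "open S \<Longrightarrow> smooth_on S (\<lambda>x. x)"
proof -
  assume "open S"
  have "Ck_on k S (\<lambda>x. x)" for k
  proof (cases k)
    case (Suc k)
    show ?thesis
      unfolding Suc by (rule Ck_on_SucI[OF \<open>open S\<close> has_derivative_ident Ck_on_const])
  qed simp
  then show ?thesis by (simp add: smooth_on_def)
qed

lemma smooth_on_add: "open S \<Longrightarrow> smooth_on S f \<Longrightarrow> smooth_on S g \<Longrightarrow> smooth_on S (\<lambda>x. f x + g x)"
  by (simp add: smooth_on_def Ck_on_add)

lemma smooth_on_mult:
  "open S \<Longrightarrow> smooth_on S f \<Longrightarrow> smooth_on S g \<Longrightarrow> smooth_on S (\<lambda>x. f x * (g x :: real))"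
  by (simp add: smooth_on_def Ck_on_mult)

lemma smooth_on_sum:
  "open S \<Longrightarrow> (\<And>i. i \<in> I \<Longrightarrow> smooth_on S (f i)) \<Longrightarrow> smooth_on S (\<lambda>x. \<Sum>i\<in>I. f i x)"
  by (simp add: smooth_on_def Ck_on_sum)

lemma smooth_on_compose:
  fixes f :: "'d::euclidean_space \<Rightarrow> 'e::euclidean_space"
  shows "open S \<Longrightarrow> open T \<Longrightarrow> f ` S \<subseteq> T \<Longrightarrow> smooth_on S f \<Longrightarrow> smooth_on T g \<Longrightarrow> smooth_on S (\<lambda>x. g (f x))"
  unfolding smooth_on_def by (intro allI Ck_on_compose[of S T f _ g]) auto

lemma smooth_on_inverse:
  assumes "open S" "smooth_on S f" "\<And>x. x \<in> S \<Longrightarrow> f x \<noteq> (0::real)"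
  shows "smooth_on S (\<lambda>x. inverse (f x))"
  using assms by (intro smooth_on_compose[of S "- {0}" f inverse])
    (auto simp: smooth_on_def Ck_on_inverse open_Compl)

lemma smooth_on_cong:
  "open S \<Longrightarrow> (\<And>x. x \<in> S \<Longrightarrow> f x = g x) \<Longrightarrow> smooth_on S f \<Longrightarrow> smooth_on S g"
  unfolding smooth_on_def by (intro allI Ck_on_cong[of S f g]) auto

lemma smooth_on_subset: "smooth_on S f \<Longrightarrow> T \<subseteq> S \<Longrightarrow> smooth_on T f"
  unfolding smooth_on_def by (intro allI Ck_on_subset[of _ S f T]) auto

lemma smooth_on_local:
  "(\<And>x. x \<in> S \<Longrightarrow> \<exists>T. open T \<and> x \<in> T \<and> smooth_on T f) \<Longrightarrow> smooth_on S f"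
  unfolding smooth_on_def by (intro allI Ck_on_local) blast

lemma smooth_on_differentiable: "smooth_on S f \<Longrightarrow> x \<in> S \<Longrightarrow> f differentiable (at x)"
  unfolding smooth_on_def by (drule spec[of _ "Suc 0"]) simp

lemma smooth_on_frechet_derivative:
  assumes "smooth_on S f"
  shows "smooth_on S (\<lambda>x. frechet_derivative f (at x) v)"
  unfolding smooth_on_def
proof
  fix k
  have "Ck_on (Suc k) S f"
    using assms by (simp only: smooth_on_def)
  then show "Ck_on k S (\<lambda>x. frechet_derivative f (at x) v)" by simp
qed

lemma smooth_on_imp_continuous_on: "smooth_on S f \<Longrightarrow> continuous_on S f"
  unfolding smooth_on_def by (drule spec[of _ 0]) simp

section \<open>Bump functions and Hadamard's lemma in Euclidean space\<close>

text \<open>The polynomial parameter makes the family closed under differentiation, so all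
  derivatives of exp(-1/t) are covered by one induction.\<close>

definition flat_exp :: "real poly \<Rightarrow> real \<Rightarrow> real" where
  "flat_exp P t = (if t > 0 then poly P (inverse t) * exp (- inverse t) else 0)"

lemma poly_exp_decay: "((\<lambda>u::real. poly P u * exp (- u)) \<longlongrightarrow> 0) at_top"
proof -
  have "((\<lambda>u. coeff P i * (u ^ i / exp u)) \<longlongrightarrow> coeff P i * 0) at_top" for i
    by (intro tendsto_intros tendsto_power_div_exp_0)
  then have "((\<lambda>u. \<Sum>i\<le>degree P. coeff P i * (u ^ i / exp u)) \<longlongrightarrow> (\<Sum>i\<le>degree P. coeff P i * 0)) at_top"
    by (intro tendsto_sum)
  then show ?thesis
    by (simp add: poly_altdef exp_minus field_simps sum_distrib_left sum_divide_distrib)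
qed

text \<open>With u = 1/t one has d/dt = - u^2 d/du, hence P(u) exp(-u) has the derivative u^2 (P(u)
  - P'(u)) exp(-u); the factor \<open>[:0,0,1:]\<close> is u^2. The only delicate point is t =
  0.\<close>

lemma flat_exp_has_derivative:
  "(flat_exp P has_real_derivative flat_exp ([:0,0,1:] * (P - pderiv P)) t) (at t)"
proof (cases "t = 0")
  case False
  show ?thesis
  proof (cases "t > 0")
    case True
    have "((\<lambda>t. poly P (inverse t) * exp (- inverse t)) has_real_derivative
       flat_exp ([:0,0,1:] * (P - pderiv P)) t) (at t)"
      using True
      by (auto intro!: derivative_eq_intros DERIV_chain2[OF poly_DERIV] simp: flat_exp_def field_simps power2_eq_square)
    then show ?thesis
      by (rule has_field_derivative_transform_within_open[of _ _ _ "{0<..}"])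
         (use True in \<open>auto simp: flat_exp_def\<close>)
  next
    case False
    with \<open>t \<noteq> 0\<close> have "t < 0" by simp
    have "((\<lambda>t. 0) has_real_derivative flat_exp ([:0,0,1:] * (P - pderiv P)) t) (at t)"
      using \<open>t < 0\<close> by (auto simp: flat_exp_def)
    then show ?thesis
      by (rule has_field_derivative_transform_within_open[of _ _ _ "{..<0}"])
         (use \<open>t < 0\<close> in \<open>auto simp: flat_exp_def\<close>)
  qed
next
  case True
  \<comment> \<open>The difference quotient at 0 is \<open>flat_exp P t / t\<close>. For t > 0 it
    equals u P(u) exp(-u) with u = 1/t, and \<open>pCons 0 P\<close> is the polynomial u P(u), so it
    tends to 0 as u tends to infinity. For t < 0 it is identically 0.\<close>
  have "((\<lambda>t. poly (pCons 0 P) (inverse t) * exp (- inverse t)) \<longlongrightarrow> 0) (at_right 0)"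
    by (rule filterlim_compose[OF poly_exp_decay filterlim_inverse_at_top_right])
  then have "((\<lambda>t. flat_exp P t / t) \<longlongrightarrow> 0) (at_right 0)"
    by (rule tendsto_cong[THEN iffD1, rotated])
       (auto simp: eventually_at_filter flat_exp_def field_simps)
  moreover have "((\<lambda>t. flat_exp P t / t) \<longlongrightarrow> 0) (at_left 0)"
    by (rule tendsto_cong[THEN iffD1, OF _ tendsto_const])
       (auto simp: eventually_at_filter flat_exp_def)
  ultimately have "((\<lambda>t. flat_exp P t / t) \<longlongrightarrow> 0) (at 0)"
    by (simp add: filterlim_split_at)
  then show ?thesis
    using True by (simp add: has_field_derivative_iff flat_exp_def)
qed

lemma smooth_on_flat_exp: "smooth_on S (flat_exp P)"
proof -
  have "Ck_on k UNIV (flat_exp P)" for k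
  proof (induction k arbitrary: P)
    case 0
    have "isCont (flat_exp P) t" for t
      using flat_exp_has_derivative by (rule DERIV_isCont)
    then show ?case by (simp add: continuous_at_imp_continuous_on)
  next
    case (Suc k)
    show ?case
      by (rule Ck_on_SucI[OF open_UNIV flat_exp_has_derivative[unfolded has_field_derivative_def]])
         (intro Ck_on_mult Suc.IH Ck_on_const open_UNIV)
  qed
  then show ?thesis
    unfolding smooth_on_def by (auto intro: Ck_on_subset[of _ UNIV])
qed

lemma smooth_step:
  obtains s :: "real \<Rightarrow> real" where "smooth_on UNIV s" "\<And>t. t \<le> 0 \<Longrightarrow> s t = 0" "\<And>t. 1 \<le> t \<Longrightarrow> s t = 1"
proof
  define e where "e = flat_exp 1"
  \<comment> \<open>The denominator is positive because t and 1 - t cannot both be nonpositive. For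
    t at least 1 its second summand is 0, which makes the quotient 1.\<close>
  define s where "s t = e t * inverse (e t + e (1 - t))" for t
  have pos: "e t > 0" if "t > 0" for t using that by (simp add: e_def flat_exp_def)
  have nn: "e t \<ge> 0" for t by (simp add: e_def flat_exp_def)
  have "e t + e (1 - t) > 0" for t
    using pos[of t] pos[of "1 - t"] nn[of t] nn[of "1 - t"] by (cases "t > 0") linarith+
  then have "e t + e (1 - t) \<noteq> 0" for t by (metis less_irrefl)
  moreover have "smooth_on UNIV (\<lambda>t. e (1 + (- t)))"
    unfolding e_def
    by (intro smooth_on_compose[OF open_UNIV open_UNIV _ _ smooth_on_flat_exp] smooth_on_add
         smooth_on_const smooth_on_bounded_linear[OF bounded_linear_minus[OF bounded_linear_ident]] smooth_on_id) auto
  ultimately show "smooth_on UNIV s"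
    unfolding s_def
    by (intro smooth_on_mult smooth_on_inverse smooth_on_add open_UNIV) (auto simp: e_def smooth_on_flat_exp)
  show "s t = 0" if "t \<le> 0" for t
    using that by (simp add: s_def e_def flat_exp_def)
  show "s t = 1" if "1 \<le> t" for t
    using that pos[of t] by (simp add: s_def e_def flat_exp_def)
qed

lemma smooth_bump_euclidean:
  fixes a :: "'e::euclidean_space"
  assumes "r > 0"
  obtains \<rho> :: "'e \<Rightarrow> real" where "smooth_on UNIV \<rho>" "\<And>x. x \<in> ball a r \<Longrightarrow> \<rho> x = 1"
    "\<And>x. x \<notin> cball a (2 * r) \<Longrightarrow> \<rho> x = 0"
proof -
  obtain s :: "real \<Rightarrow> real" where s: "smooth_on UNIV s" "\<And>t. t \<le> 0 \<Longrightarrow> s t = 0" "\<And>t. 1 \<le> t \<Longrightarrow> s t = 1"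
    by (rule smooth_step) blast
  \<comment> \<open>The squared distance is used since the norm is not differentiable at 0. The
    constant 4 makes q at least 3 on the ball of radius r and at most 0 outside the closed ball of
    radius 2 r. Differences are written as sums with negated terms to match the closure rules for
    sums, products and linear maps.\<close>
  define q where "q x = 4 + (- inverse (r\<^sup>2)) * (\<Sum>b\<in>Basis. ((x + - a) \<bullet> b) * ((x + - a) \<bullet> b))" for x
  have q: "q x = 4 - (dist a x / r)\<^sup>2" for x
    unfolding q_def euclidean_inner[symmetric]
    by (simp add: dist_norm norm_minus_commute dot_square_norm power_divide field_simps)
  show ?thesis
  proof
    have "smooth_on UNIV q"
      unfolding q_def
      by (intro smooth_on_add smooth_on_mult smooth_on_sum smooth_on_const open_UNIV smooth_on_id
          smooth_on_bounded_linear[OF bounded_linear_inner_left])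
    then show "smooth_on UNIV (\<lambda>x. s (q x))"
      by (intro smooth_on_compose[OF open_UNIV open_UNIV _ _ s(1)]) auto
    show "s (q x) = 1" if "x \<in> ball a r" for x
    proof (rule s(3))
      have "(dist a x / r)\<^sup>2 \<le> 1\<^sup>2"
        using that assms by (intro power_mono) auto
      then show "1 \<le> q x" by (simp add: q)
    qed
    show "s (q x) = 0" if "x \<notin> cball a (2 * r)" for x
    proof (rule s(2))
      have "2\<^sup>2 \<le> (dist a x / r)\<^sup>2"
        using that assms by (intro power_mono) (auto simp: field_simps)
      then show "q x \<le> 0" by (simp add: q)
    qed
  qed
qed

text \<open>Differentiating under the integral sign produces an inner factor t, so t^m turns into
  t^(m+1). The weight is there to make the induction on k close, with m and f arbitrary; Hadamard's
  lemma takes m = 0.\<close>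

lemma Ck_on_segment_average:
  fixes f :: "'e::euclidean_space \<Rightarrow> real"
  assumes "convex C" "open C" "a \<in> C" "smooth_on C f"
  shows "Ck_on k C (\<lambda>x. integral {0..1} (\<lambda>t. t ^ m * f (a + t *\<^sub>R (x - a))))"
  using assms(4)
proof (induction k arbitrary: f m)
  case (0 f m)
  have seg: "a + t *\<^sub>R (x - a) \<in> C" if "x \<in> C" "t \<in> {0..1}" for x t
    using convexD_alt[OF assms(1,3) that(1), of t] that(2) by (simp add: algebra_simps)
  have "continuous_on C f"
    using 0 by (rule smooth_on_imp_continuous_on)
  then have "continuous_on (C \<times> cbox 0 1) (\<lambda>(x, t). t ^ m * f (a + t *\<^sub>R (x - a)))"
    unfolding split_beta
    by (intro continuous_on_mult continuous_on_compose2[of C f _ "\<lambda>p. a + snd p *\<^sub>R (fst p - a)"])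
       (auto intro!: continuous_intros seg)
  from integral_continuous_on_param[OF this] show ?case by simp
next
  case (Suc k f m)
  have seg: "a + t *\<^sub>R (x - a) \<in> C" if "x \<in> C" "t \<in> {0..1}" for x t
    using convexD_alt[OF assms(1,3) that(1), of t] that(2) by (simp add: algebra_simps)
  let ?D = "\<lambda>y. frechet_derivative f (at y)"
  have der: "(f has_derivative ?D y) (at y)" if "y \<in> C" for y
    using smooth_on_differentiable[OF Suc.prems that] by (simp add: frechet_derivative_works)
  have contf: "continuous_on C f"
    using Suc.prems by (rule smooth_on_imp_continuous_on)
  have contD: "continuous_on C (\<lambda>y. ?D y v)" for v
    by (rule smooth_on_imp_continuous_on[OF smooth_on_frechet_derivative[OF Suc.prems]])
  \<comment> \<open>The Leibniz rule for integrals expects the derivative as a bounded linear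
    function that is jointly continuous in x and t. \<open>Blinfun\<close> is only meaningful on
    bounded linear arguments, hence the restriction of \<open>fx\<close> to x in C and t in [0, 1].
    Joint continuity is then checked on basis vectors.\<close>
  let ?fx = "\<lambda>x t. Blinfun (\<lambda>v. t ^ Suc m * ?D (a + t *\<^sub>R (x - a)) v)"
  have fx: "blinfun_apply (?fx x t) = (\<lambda>v. t ^ Suc m * ?D (a + t *\<^sub>R (x - a)) v)"
    if "x \<in> C" "t \<in> {0..1}" for x t
    by (rule bounded_linear_Blinfun_apply)
       (intro bounded_linear_const_mult has_derivative_bounded_linear[OF der] seg that)
  have cont1: "continuous_on (C \<times> {0..1}) (\<lambda>(x, t). t ^ Suc m * ?D (a + t *\<^sub>R (x - a)) v)" for v
    unfolding split_beta
    by (intro continuous_on_mult continuous_on_compose2[OF contD, of _ "\<lambda>p. a + snd p *\<^sub>R (fst p - a)"])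
       (auto intro!: continuous_intros seg)
  have cont2: "continuous_on {0..1} (\<lambda>t. t ^ m * f (a + t *\<^sub>R (x - a)))" if "x \<in> C" for x
    by (intro continuous_on_mult continuous_on_compose2[OF contf, of _ "\<lambda>t. a + t *\<^sub>R (x - a)"])
       (auto intro!: continuous_intros seg that)
  have contb: "continuous_on (C \<times> {0..1}) (\<lambda>(x, t). ?fx x t)"
  proof (rule continuous_on_blinfun_componentwise)
    fix i :: 'e
    show "continuous_on (C \<times> {0..1}) (\<lambda>z. blinfun_apply (case z of (x, t) \<Rightarrow> ?fx x t) i)"
      by (rule continuous_on_eq[OF cont1[of i]]) (use fx in auto)
  qed
  have D0: "((\<lambda>x. integral (cbox 0 1) (\<lambda>t. t ^ m * f (a + t *\<^sub>R (x - a)))) has_derivative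
      blinfun_apply (integral (cbox 0 1) (?fx x))) (at x within C)" if "x \<in> C" for x
  proof (rule leibniz_rule[OF _ _ _ that assms(1)])
    fix x t assume xt: "x \<in> C" "t \<in> cbox 0 (1::real)"
    have "(f has_derivative ?D (a + t *\<^sub>R (x - a))) (at (a + t *\<^sub>R (x - a)))"
      using xt by (intro der seg) auto
    then have "((\<lambda>x. f (a + t *\<^sub>R (x - a))) has_derivative (\<lambda>v. ?D (a + t *\<^sub>R (x - a)) (t *\<^sub>R v))) (at x within C)"
      by (rule has_derivative_compose[rotated]) (auto intro!: derivative_eq_intros)
    moreover have "?D (a + t *\<^sub>R (x - a)) (t *\<^sub>R v) = t * ?D (a + t *\<^sub>R (x - a)) v" for v
      using linear_cmul[OF has_derivative_linear[OF der[OF seg]]] xt by simp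
    ultimately have "((\<lambda>x. t ^ m * f (a + t *\<^sub>R (x - a))) has_derivative
        (\<lambda>v. t ^ m * (t * ?D (a + t *\<^sub>R (x - a)) v))) (at x within C)"
      by (intro has_derivative_mult_right) simp
    moreover have "blinfun_apply (?fx x t) = (\<lambda>v. t ^ m * (t * ?D (a + t *\<^sub>R (x - a)) v))"
      by (subst fx) (use xt in \<open>auto simp: mult_ac\<close>)
    ultimately show "((\<lambda>x. t ^ m * f (a + t *\<^sub>R (x - a))) has_derivative blinfun_apply (?fx x t)) (at x within C)"
      by (simp only:)
  next
    show "(\<lambda>t. t ^ m * f (a + t *\<^sub>R (x - a))) integrable_on cbox 0 1" if "x \<in> C" for x
      using cont2[OF that] by (simp add: integrable_continuous_interval)
    show "continuous_on (C \<times> cbox 0 1) (\<lambda>(x, t). ?fx x t)"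
      using contb by simp
  qed
  have D1: "blinfun_apply (integral (cbox 0 1) (?fx x)) v = integral {0..1} (\<lambda>t. t ^ Suc m * ?D (a + t *\<^sub>R (x - a)) v)"
    if "x \<in> C" for x v
  proof -
    have "continuous_on {0..1} (\<lambda>t. (x, t))"
      by (intro continuous_intros)
    from continuous_on_compose2[OF contb this] that have "continuous_on (cbox 0 1) (?fx x)"
      by (simp add: image_subset_iff)
    from blinfun_apply_integral[OF integrable_continuous[OF this], of v]
    have "blinfun_apply (integral (cbox 0 1) (?fx x)) v = integral (cbox 0 1) (\<lambda>t. blinfun_apply (?fx x t) v)"
      by simp
    also have "\<dots> = integral {0..1} (\<lambda>t. t ^ Suc m * ?D (a + t *\<^sub>R (x - a)) v)"
    proof -
      have "integral {0..1} (\<lambda>t. blinfun_apply (?fx x t) v) = integral {0..1} (\<lambda>t. t ^ Suc m * ?D (a + t *\<^sub>R (x - a)) v)"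
        by (rule integral_cong) (use fx that in metis)
      then show ?thesis by (simp only: box_real)
    qed
    finally show ?thesis .
  qed
  have D2: "((\<lambda>x. integral {0..1} (\<lambda>t. t ^ m * f (a + t *\<^sub>R (x - a)))) has_derivative
      (\<lambda>v. integral {0..1} (\<lambda>t. t ^ Suc m * ?D (a + t *\<^sub>R (x - a)) v))) (at x)" if "x \<in> C" for x
  proof -
    have "blinfun_apply (integral (cbox 0 1) (?fx x)) =
        (\<lambda>v. integral {0..1} (\<lambda>t. t ^ Suc m * ?D (a + t *\<^sub>R (x - a)) v))"
      by (rule ext, rule D1[OF that])
    with D0[OF that] at_within_open[OF that assms(2)] show ?thesis
      by (simp only: box_real)
  qed
  show ?case
    by (rule Ck_on_SucI[OF assms(2) D2 Suc.IH[OF smooth_on_frechet_derivative[OF Suc.prems]]])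
qed

text \<open>The difference f x - f a is the integral of the derivative of f along the segment from a
  to x, whose velocity is x - a. Expanding the velocity in the basis shows that the factors
  \<open>g i\<close> are the partial derivatives averaged over the segment; at x = a the average is
  the partial derivative itself.\<close>

lemma hadamard:
  fixes f :: "'e::euclidean_space \<Rightarrow> real"
  assumes "convex C" "open C" "a \<in> C" "smooth_on C f"
  shows "\<exists>g. (\<forall>i. smooth_on C (g i)) \<and> (\<forall>i. g i a = frechet_derivative f (at a) i) \<and>
    (\<forall>x\<in>C. f x = f a + (\<Sum>i\<in>Basis. ((x - a) \<bullet> i) * g i x))"
proof -
  let ?D = "\<lambda>y. frechet_derivative f (at y)"
  define g where "g i x = integral {0..1} (\<lambda>t. ?D (a + t *\<^sub>R (x - a)) i)" for i x
  have 1: "smooth_on C (g i)" for i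
    unfolding smooth_on_def g_def
    using Ck_on_segment_average[OF assms(1-3) smooth_on_frechet_derivative[OF assms(4)], of _ 0]
    by simp
  have 2: "g i a = ?D a i" for i
    by (simp add: g_def)
  have 3: "f x = f a + (\<Sum>i\<in>Basis. ((x - a) \<bullet> i) * g i x)" if x: "x \<in> C" for x
  proof -
    have seg: "a + t *\<^sub>R (x - a) \<in> C" if "t \<in> {0..1}" for t
      using convexD_alt[OF assms(1,3) x, of t] that by (simp add: algebra_simps)
    have der: "(f has_derivative ?D y) (at y)" if "y \<in> C" for y
      using smooth_on_differentiable[OF assms(4) that] by (simp add: frechet_derivative_works)
    have contD: "continuous_on C (\<lambda>y. ?D y v)" for v
      by (rule smooth_on_imp_continuous_on[OF smooth_on_frechet_derivative[OF assms(4)]])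
    have int: "(\<lambda>t. ?D (a + t *\<^sub>R (x - a)) i) integrable_on {0..1}" for i
      by (intro integrable_continuous_interval continuous_on_compose2[OF contD, of _ "\<lambda>t. a + t *\<^sub>R (x - a)"])
         (auto intro!: continuous_intros seg)
    have "((\<lambda>t. f (a + t *\<^sub>R (x - a))) has_vector_derivative ?D (a + t *\<^sub>R (x - a)) (x - a)) (at t within {0..1})"
      if "t \<in> {0..1}" for t
    proof -
      note d = der[OF seg[OF that]]
      have "((\<lambda>t. f (a + t *\<^sub>R (x - a))) has_derivative (\<lambda>s. ?D (a + t *\<^sub>R (x - a)) (s *\<^sub>R (x - a)))) (at t within {0..1})"
        by (rule has_derivative_compose[of "\<lambda>t. a + t *\<^sub>R (x - a)" "\<lambda>s. s *\<^sub>R (x - a)" t "{0..1}" f, OF _ d]) (auto intro!: derivative_eq_intros)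
      then show ?thesis
        by (simp add: has_vector_derivative_def linear_cmul[OF has_derivative_linear[OF d]])
    qed
    from fundamental_theorem_of_calculus[OF _ this]
    have "((\<lambda>t. ?D (a + t *\<^sub>R (x - a)) (x - a)) has_integral f x - f a) {0..1}" by simp
    moreover have "((\<lambda>t. ?D (a + t *\<^sub>R (x - a)) (x - a)) has_integral (\<Sum>i\<in>Basis. ((x - a) \<bullet> i) * g i x)) {0..1}"
    proof (rule has_integral_eq)
      show "((\<lambda>t. \<Sum>i\<in>Basis. ((x - a) \<bullet> i) * ?D (a + t *\<^sub>R (x - a)) i) has_integral (\<Sum>i\<in>Basis. ((x - a) \<bullet> i) * g i x)) {0..1}"
        unfolding g_def by (intro has_integral_sum has_integral_mult_right integrable_integral int) auto
      fix t :: real assume "t \<in> {0..1}"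
      then have lin: "linear (?D (a + t *\<^sub>R (x - a)))"
        by (intro has_derivative_linear[OF der] seg)
      have "?D (a + t *\<^sub>R (x - a)) (\<Sum>i\<in>Basis. ((x - a) \<bullet> i) *\<^sub>R i) = (\<Sum>i\<in>Basis. ((x - a) \<bullet> i) * ?D (a + t *\<^sub>R (x - a)) i)"
        by (simp add: linear_sum[OF lin] linear_cmul[OF lin] del: euclidean_representation)
      then show "(\<Sum>i\<in>Basis. ((x - a) \<bullet> i) * ?D (a + t *\<^sub>R (x - a)) i) = ?D (a + t *\<^sub>R (x - a)) (x - a)"
        by (simp add: euclidean_representation)
    qed
    ultimately have "f x - f a = (\<Sum>i\<in>Basis. ((x - a) \<bullet> i) * g i x)"
      by (rule has_integral_unique)
    then show ?thesis by simp
  qed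
  show ?thesis
    by (intro exI[of _ g] conjI allI ballI 1 2 3)
qed

section \<open>Smooth functions on a manifold\<close>

text \<open>Smoothness on a part of M, for functions such as frame coefficients and Cramer quotients
  that are controlled only near a point. It allows global smoothness to be glued from
  neighbourhoods.\<close>

definition smooth_fun_on :: "('a, 'e::euclidean_space) manifold \<Rightarrow> 'a set \<Rightarrow> ('a \<Rightarrow> real) \<Rightarrow> bool" where
  "smooth_fun_on M N f \<longleftrightarrow> (\<forall>(U, \<phi>)\<in>atlas M. smooth_on (\<phi> ` (U \<inter> N)) (f \<circ> inv_into U \<phi>))"

lemma smooth_fun_onD: "smooth_fun_on M N f \<Longrightarrow> (U, \<phi>) \<in> atlas M \<Longrightarrow> smooth_on (\<phi> ` (U \<inter> N)) (f \<circ> inv_into U \<phi>)"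
  by (auto simp: smooth_fun_on_def)

lemma smooth_fun_on_subset: "smooth_fun_on M N f \<Longrightarrow> N' \<subseteq> N \<Longrightarrow> smooth_fun_on M N' f"
  unfolding smooth_fun_on_def
  by (fast intro: smooth_on_subset image_mono)

locale smooth_mfd =
  fixes M :: "('a, 'e::euclidean_space) manifold"
  assumes smooth_manifold: "smooth_manifold M"
begin

lemma Hausdorff: "Hausdorff_space (mtop M)"
  using smooth_manifold by (simp add: smooth_manifold_def)

lemma chart_at:
  assumes "p \<in> points M"
  obtains U \<phi> where "(U, \<phi>) \<in> atlas M" "p \<in> U"
proof -
  have "(\<Union>(U, \<phi>)\<in>atlas M. U) = points M"
    using smooth_manifold by (simp add: smooth_manifold_def)
  with assms that show ?thesis by blast
qed

context
  fixes U \<phi>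
  assumes chart: "(U, \<phi>) \<in> atlas M"
begin

lemma chart_properties:
  "openin (mtop M) U" "open (\<phi> ` U)"
  "homeomorphic_map (subtopology (mtop M) U) (top_of_set (\<phi> ` U)) \<phi>"
  using smooth_manifold chart unfolding smooth_manifold_def by blast+

lemma chart_subset: "U \<subseteq> points M"
  using chart_properties(1) by (rule openin_subset)

lemma topspace_chart: "topspace (subtopology (mtop M) U) = U"
  using chart_subset by (auto simp: topspace_subtopology)

lemma inj_on_chart: "inj_on \<phi> U"
  using homeomorphic_imp_injective_map[OF chart_properties(3)] unfolding topspace_chart .

lemma chart_inverse: "q \<in> U \<Longrightarrow> inv_into U \<phi> (\<phi> q) = q"
  by (rule inv_into_f_f[OF inj_on_chart])

lemma open_chart_image:
  assumes "openin (mtop M) N"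
  shows "open (\<phi> ` (U \<inter> N))"
proof -
  have "openin (subtopology (mtop M) U) (U \<inter> N)"
    using assms by (rule openin_subtopology_Int2)
  then have "openin (top_of_set (\<phi> ` U)) (\<phi> ` (U \<inter> N))"
    using homeomorphic_map_openness_eq[OF chart_properties(3)] by blast
  then show ?thesis
    using chart_properties(2) by (simp add: openin_open_eq)
qed

lemma openin_chart_vimage:
  assumes "open B"
  shows "openin (mtop M) {q \<in> U. \<phi> q \<in> B}"
proof -
  have "openin (top_of_set (\<phi> ` U)) (\<phi> ` U \<inter> B)"
    using assms by (rule openin_open_Int)
  from openin_continuous_map_preimage[OF homeomorphic_imp_continuous_map[OF chart_properties(3)] this]
  have "openin (subtopology (mtop M) U) {q \<in> U. \<phi> q \<in> \<phi> ` U \<inter> B}"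
    unfolding topspace_chart .
  then have "openin (mtop M) {q \<in> U. \<phi> q \<in> \<phi> ` U \<inter> B}"
    using chart_properties(1) by (rule openin_trans_full)
  moreover have "{q \<in> U. \<phi> q \<in> \<phi> ` U \<inter> B} = {q \<in> U. \<phi> q \<in> B}"
    by auto
  ultimately show ?thesis by simp
qed

text \<open>A set that is closed in a chart domain may fail to be closed in M. Compactness does
  survive the passage to the larger space, and in a Hausdorff space it gives closedness. This is
  what allows functions to be extended by 0 beyond a chart.\<close>

lemma closedin_chart_vimage:
  assumes "compact K" "K \<subseteq> \<phi> ` U"
  shows "closedin (mtop M) {q \<in> U. \<phi> q \<in> K}"
proof (rule compactin_imp_closedin[OF Hausdorff])
  have "\<phi> ` {q \<in> U. \<phi> q \<in> K} = K"
    using assms(2) by auto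
  moreover have "compactin (top_of_set (\<phi> ` U)) K"
    using assms by (simp add: compactin_subtopology)
  ultimately have "compactin (subtopology (mtop M) U) {q \<in> U. \<phi> q \<in> K}"
    using homeomorphic_map_compactness[OF chart_properties(3), of "{q \<in> U. \<phi> q \<in> K}"]
    unfolding topspace_chart by simp
  then show "compactin (mtop M) {q \<in> U. \<phi> q \<in> K}"
    by (simp add: compactin_subtopology)
qed

end

section \<open>Smooth functions on M: locality, algebra, cut-off\<close>

lemma smooth_transition:
  "(U, \<phi>) \<in> atlas M \<Longrightarrow> (V, \<psi>) \<in> atlas M \<Longrightarrow> smooth_on (\<phi> ` (U \<inter> V)) (\<psi> \<circ> inv_into U \<phi>)"
  using smooth_manifold unfolding smooth_manifold_def by blast

lemma smooth_functions_iff: "f \<in> smooth_functions M \<longleftrightarrow> smooth_fun_on M (points M) f"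
proof -
  have "U \<inter> points M = U" if "(U, \<phi>) \<in> atlas M" for U \<phi>
    using chart_subset[OF that] by auto
  then show ?thesis
    unfolding smooth_functions_def smooth_fun_on_def by fastforce
qed

lemma smooth_fun_on_cong:
  assumes "openin (mtop M) N" "smooth_fun_on M N f" "\<And>q. q \<in> N \<Longrightarrow> f q = g q"
  shows "smooth_fun_on M N g"
  unfolding smooth_fun_on_def
proof clarify
  fix U \<phi> assume c: "(U, \<phi>) \<in> atlas M"
  show "smooth_on (\<phi> ` (U \<inter> N)) (g \<circ> inv_into U \<phi>)"
    by (rule smooth_on_cong[OF open_chart_image[OF c assms(1)] _ smooth_fun_onD[OF assms(2) c]])
       (use assms(3) in \<open>auto simp: chart_inverse[OF c]\<close>)
qed

lemma smooth_fun_on_local: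
  assumes "\<And>p. p \<in> N \<Longrightarrow> \<exists>W. openin (mtop M) W \<and> p \<in> W \<and> smooth_fun_on M W f"
  shows "smooth_fun_on M N f"
  unfolding smooth_fun_on_def
proof clarify
  fix U \<phi> assume c: "(U, \<phi>) \<in> atlas M"
  show "smooth_on (\<phi> ` (U \<inter> N)) (f \<circ> inv_into U \<phi>)"
  proof (rule smooth_on_local)
    fix y assume "y \<in> \<phi> ` (U \<inter> N)"
    then obtain p where p: "p \<in> U" "p \<in> N" "y = \<phi> p" by auto
    from assms[OF p(2)] obtain W where "openin (mtop M) W" "p \<in> W" "smooth_fun_on M W f" by blast
    with p show "\<exists>T. open T \<and> y \<in> T \<and> smooth_on T (f \<circ> inv_into U \<phi>)"
      by (intro exI[of _ "\<phi> ` (U \<inter> W)"]) (auto intro: open_chart_image[OF c] smooth_fun_onD[OF _ c])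
  qed
qed

lemma smooth_fun_on_const: "smooth_fun_on M N (\<lambda>_. c)"
  by (auto simp: smooth_fun_on_def o_def smooth_on_const)

lemma smooth_fun_on_add:
  assumes "openin (mtop M) N" "smooth_fun_on M N f" "smooth_fun_on M N g"
  shows "smooth_fun_on M N (\<lambda>q. f q + g q)"
  unfolding smooth_fun_on_def
proof clarify
  fix U \<phi> assume c: "(U, \<phi>) \<in> atlas M"
  show "smooth_on (\<phi> ` (U \<inter> N)) ((\<lambda>q. f q + g q) \<circ> inv_into U \<phi>)"
    using smooth_on_add[OF open_chart_image[OF c assms(1)] assms(2,3)[THEN smooth_fun_onD[OF _ c]]]
    by (simp add: o_def)
qed

lemma smooth_fun_on_mult:
  assumes "openin (mtop M) N" "smooth_fun_on M N f" "smooth_fun_on M N g"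
  shows "smooth_fun_on M N (\<lambda>q. f q * g q)"
  unfolding smooth_fun_on_def
proof clarify
  fix U \<phi> assume c: "(U, \<phi>) \<in> atlas M"
  show "smooth_on (\<phi> ` (U \<inter> N)) ((\<lambda>q. f q * g q) \<circ> inv_into U \<phi>)"
    using smooth_on_mult[OF open_chart_image[OF c assms(1)] assms(2,3)[THEN smooth_fun_onD[OF _ c]]]
    by (simp add: o_def)
qed

lemma smooth_fun_on_inverse:
  assumes "openin (mtop M) N" "smooth_fun_on M N f" "\<And>q. q \<in> N \<Longrightarrow> f q \<noteq> 0"
  shows "smooth_fun_on M N (\<lambda>q. inverse (f q))"
  unfolding smooth_fun_on_def
proof clarify
  fix U \<phi> assume c: "(U, \<phi>) \<in> atlas M"
  have "(f \<circ> inv_into U \<phi>) y \<noteq> 0" if "y \<in> \<phi> ` (U \<inter> N)" for y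
    using that assms(3) by (auto simp: chart_inverse[OF c])
  from smooth_on_inverse[OF open_chart_image[OF c assms(1)] smooth_fun_onD[OF assms(2) c] this]
  show "smooth_on (\<phi> ` (U \<inter> N)) ((\<lambda>q. inverse (f q)) \<circ> inv_into U \<phi>)"
    by (simp add: o_def)
qed

lemma smooth_fun_on_sum:
  assumes "openin (mtop M) N" "\<And>i. i \<in> I \<Longrightarrow> smooth_fun_on M N (f i)"
  shows "smooth_fun_on M N (\<lambda>q. \<Sum>i\<in>I. f i q)"
  using assms(2)
  by (induction I rule: infinite_finite_induct)
     (auto intro: smooth_fun_on_const smooth_fun_on_add assms(1))

lemma smooth_fun_on_prod:
  assumes "openin (mtop M) N" "\<And>i. i \<in> I \<Longrightarrow> smooth_fun_on M N (f i)"
  shows "smooth_fun_on M N (\<lambda>q. \<Prod>i\<in>I. f i q)"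
  using assms(2)
  by (induction I rule: infinite_finite_induct)
     (auto intro: smooth_fun_on_const smooth_fun_on_mult assms(1))

lemma smooth_functions_const: "(\<lambda>_. c) \<in> smooth_functions M"
  by (simp add: smooth_functions_iff smooth_fun_on_const)

lemma smooth_functions_add:
  "f \<in> smooth_functions M \<Longrightarrow> g \<in> smooth_functions M \<Longrightarrow> f + g \<in> smooth_functions M"
  by (simp add: smooth_functions_iff smooth_fun_on_add plus_fun_def)

lemma smooth_functions_mult:
  "f \<in> smooth_functions M \<Longrightarrow> g \<in> smooth_functions M \<Longrightarrow> f * g \<in> smooth_functions M"
  by (simp add: smooth_functions_iff smooth_fun_on_mult times_fun_def)

lemma smooth_functions_cmult:
  "f \<in> smooth_functions M \<Longrightarrow> (\<lambda>q. c * f q) \<in> smooth_functions M"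
  using smooth_functions_mult[OF smooth_functions_const] by (simp add: times_fun_def)

lemma smooth_functions_diff:
  assumes "f \<in> smooth_functions M" "g \<in> smooth_functions M"
  shows "f - g \<in> smooth_functions M"
proof -
  have "f - g = f + (\<lambda>q. (-1) * g q)"
    by (simp add: fun_eq_iff)
  then show ?thesis
    using smooth_functions_add[OF assms(1) smooth_functions_cmult[OF assms(2)]] by metis
qed

lemma smooth_functions_sum:
  "(\<And>i. i \<in> I \<Longrightarrow> f i \<in> smooth_functions M) \<Longrightarrow> (\<lambda>q. \<Sum>i\<in>I. f i q) \<in> smooth_functions M"
  by (simp add: smooth_functions_iff smooth_fun_on_sum)

text \<open>One chart suffices: in any other chart the function is its expression in the first chart
  composed with a smooth transition map.\<close>

lemma smooth_fun_on_chartI: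
  assumes c: "(U, \<phi>) \<in> atlas M" and N: "openin (mtop M) N" "N \<subseteq> U"
    and sm: "smooth_on (\<phi> ` N) (f \<circ> inv_into U \<phi>)"
  shows "smooth_fun_on M N f"
  unfolding smooth_fun_on_def
proof clarify
  fix V \<psi> assume d: "(V, \<psi>) \<in> atlas M"
  note open_V = open_chart_image[OF d N(1)]
  have "U \<inter> N = N" using N(2) by auto
  with open_chart_image[OF c N(1)] have open_U: "open (\<phi> ` N)" by simp
  have t: "smooth_on (\<psi> ` (V \<inter> N)) (\<phi> \<circ> inv_into V \<psi>)"
    by (rule smooth_on_subset[OF smooth_transition[OF d c]]) (use N(2) in auto)
  have img: "(\<phi> \<circ> inv_into V \<psi>) ` \<psi> ` (V \<inter> N) \<subseteq> \<phi> ` N"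
    by (auto simp: chart_inverse[OF d])
  have "smooth_on (\<psi> ` (V \<inter> N)) (\<lambda>y. (f \<circ> inv_into U \<phi>) ((\<phi> \<circ> inv_into V \<psi>) y))"
    by (rule smooth_on_compose[OF open_V open_U img t sm])
  then show "smooth_on (\<psi> ` (V \<inter> N)) (f \<circ> inv_into V \<psi>)"
  proof (rule smooth_on_cong[OF open_V, rotated])
    fix y assume "y \<in> \<psi> ` (V \<inter> N)"
    then obtain q where "q \<in> V" "q \<in> N" "y = \<psi> q" by auto
    then show "(f \<circ> inv_into U \<phi>) ((\<phi> \<circ> inv_into V \<psi>) y) = (f \<circ> inv_into V \<psi>) y"
      using N(2) by (auto simp: chart_inverse[OF d] chart_inverse[OF c])
  qed
qed

text \<open>Two open sets cover M: the part of the chart over C, where the product of \<rho> and g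
  is smooth, and the complement of the part over K, where the function is identically 0. The second
  set is open because K is compact.\<close>

lemma smooth_extension_by_zero:
  assumes c: "(U, \<phi>) \<in> atlas M" and "open C" "C \<subseteq> \<phi> ` U" "compact K" "K \<subseteq> C"
    and \<rho>: "smooth_on UNIV \<rho>" "\<And>y. y \<notin> K \<Longrightarrow> \<rho> y = (0::real)" and g: "smooth_on C g"
  shows "(\<lambda>q. if q \<in> U then \<rho> (\<phi> q) * g (\<phi> q) else 0) \<in> smooth_functions M"
  unfolding smooth_functions_iff
proof (rule smooth_fun_on_local)
  let ?f = "\<lambda>q. if q \<in> U then \<rho> (\<phi> q) * g (\<phi> q) else 0"
  fix p assume p: "p \<in> points M"
  show "\<exists>W. openin (mtop M) W \<and> p \<in> W \<and> smooth_fun_on M W ?f"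
  proof (cases "p \<in> U \<and> \<phi> p \<in> C")
    case True
    let ?W = "{q \<in> U. \<phi> q \<in> C}"
    have W: "openin (mtop M) ?W"
      by (rule openin_chart_vimage[OF c assms(2)])
    have img: "\<phi> ` ?W = C" using assms(3) by auto
    have "smooth_on C (\<lambda>y. \<rho> y * g y)"
      by (intro smooth_on_mult assms(2) g smooth_on_subset[OF \<rho>(1)]) auto
    then have "smooth_on C (?f \<circ> inv_into U \<phi>)"
      by (rule smooth_on_cong[OF assms(2), rotated])
         (use assms(3) in \<open>auto simp: inv_into_into f_inv_into_f subset_iff\<close>)
    then have "smooth_fun_on M ?W ?f"
      by (intro smooth_fun_on_chartI[OF c W]) (auto simp: img)
    with True W show ?thesis by blast
  next
    case False
    let ?W = "points M - {q \<in> U. \<phi> q \<in> K}"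
    have W: "openin (mtop M) ?W"
      using closedin_chart_vimage[OF c assms(4)] assms(3,5) by (auto simp: closedin_def)
    have "smooth_fun_on M ?W ?f"
      by (rule smooth_fun_on_cong[OF W smooth_fun_on_const[of _ 0]]) (use \<rho>(2) in auto)
    moreover have "p \<in> ?W" using False p assms(5) by auto
    ultimately show ?thesis using W by blast
  qed
qed

text \<open>The value 1 at the single point p is enough for the uses below, where an identity
  multiplied by \<rho> holds on all of M and is then evaluated at p or differentiated there by the
  product rule.\<close>

lemma bump_function:
  assumes "openin (mtop M) N" "p \<in> N"
  obtains \<rho> where "\<rho> \<in> smooth_functions M" "\<rho> p = 1" "\<And>q. q \<notin> N \<Longrightarrow> \<rho> q = 0"
proof -
  have "p \<in> points M" using assms openin_subset by blast
  then obtain U \<phi> where c: "(U, \<phi>) \<in> atlas M" "p \<in> U" by (rule chart_at)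
  let ?C = "\<phi> ` (U \<inter> N)"
  have C: "open ?C" by (rule open_chart_image[OF c(1) assms(1)])
  moreover have "\<phi> p \<in> ?C" using c assms by auto
  ultimately obtain e where e: "e > 0" "cball (\<phi> p) e \<subseteq> ?C"
    by (meson open_contains_cball)
  obtain \<rho> :: "'e \<Rightarrow> real" where \<rho>: "smooth_on UNIV \<rho>" "\<And>x. x \<in> ball (\<phi> p) (e / 2) \<Longrightarrow> \<rho> x = 1"
    "\<And>x. x \<notin> cball (\<phi> p) (2 * (e / 2)) \<Longrightarrow> \<rho> x = 0"
    using smooth_bump_euclidean[of "e / 2" "\<phi> p"] e(1) by (metis half_gt_zero)
  show ?thesis
  proof
    show "(\<lambda>q. if q \<in> U then \<rho> (\<phi> q) * 1 else 0) \<in> smooth_functions M"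
      by (rule smooth_extension_by_zero[OF c(1) C _ compact_cball e(2) \<rho>(1) _ smooth_on_const])
         (use \<rho>(3) in auto)
    show "(if p \<in> U then \<rho> (\<phi> p) * 1 else 0) = 1"
      using c(2) \<rho>(2) e(1) by simp
    show "(if q \<in> U then \<rho> (\<phi> q) * 1 else 0) = 0" if "q \<notin> N" for q
    proof (cases "q \<in> U")
      case True
      have "\<phi> q \<notin> cball (\<phi> p) e"
      proof
        assume "\<phi> q \<in> cball (\<phi> p) e"
        with e(2) obtain q' where "q' \<in> U" "q' \<in> N" "\<phi> q = \<phi> q'" by blast
        with True that inj_onD[OF inj_on_chart[OF c(1)]] show False by metis
      qed
      with True \<rho>(3) show ?thesis by simp
    qed simp
  qed
qed

section \<open>Tangent vectors and local frames\<close>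

lemma tangent_add:
  "v \<in> tangent_space M p \<Longrightarrow> f \<in> smooth_functions M \<Longrightarrow> g \<in> smooth_functions M \<Longrightarrow> v (f + g) = v f + v g"
  by (simp add: tangent_space_def)

lemma tangent_cmult:
  "v \<in> tangent_space M p \<Longrightarrow> f \<in> smooth_functions M \<Longrightarrow> v (\<lambda>q. c * f q) = c * v f"
  by (simp add: tangent_space_def)

lemma tangent_mult:
  "v \<in> tangent_space M p \<Longrightarrow> f \<in> smooth_functions M \<Longrightarrow> g \<in> smooth_functions M \<Longrightarrow> v (f * g) = f p * v g + g p * v f"
  by (simp add: tangent_space_def)

lemma tangent_not_smooth: "v \<in> tangent_space M p \<Longrightarrow> f \<notin> smooth_functions M \<Longrightarrow> v f = 0"
  by (simp add: tangent_space_def)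

lemma tangent_const:
  assumes "v \<in> tangent_space M p"
  shows "v (\<lambda>_. c) = 0"
proof -
  have "v ((\<lambda>_. 1) * (\<lambda>_. 1)) = 1 * v (\<lambda>_. 1) + 1 * v (\<lambda>_. 1)"
    using tangent_mult[OF assms smooth_functions_const smooth_functions_const, of 1 1] by simp
  then have "v (\<lambda>_. 1) = 0" by (simp add: times_fun_def)
  then show ?thesis
    using tangent_cmult[OF assms smooth_functions_const, of c 1] by simp
qed

lemma tangent_diff:
  assumes v: "v \<in> tangent_space M p" and fg: "f \<in> smooth_functions M" "g \<in> smooth_functions M"
  shows "v (f - g) = v f - v g"
proof -
  have "f - g = f + (\<lambda>q. (-1) * g q)"
    by (simp add: fun_eq_iff)
  then show ?thesis
    using tangent_add[OF v fg(1) smooth_functions_cmult[OF fg(2)], of "-1"] tangent_cmult[OF v fg(2), of "-1"]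
    by (metis diff_conv_add_uminus mult_minus1)
qed

lemma tangent_sum:
  assumes v: "v \<in> tangent_space M p" and "\<And>i. i \<in> I \<Longrightarrow> f i \<in> smooth_functions M"
  shows "v (\<lambda>q. \<Sum>i\<in>I. f i q) = (\<Sum>i\<in>I. v (f i))"
  using assms(2)
proof (induction I rule: infinite_finite_induct)
  case (insert i I)
  then have "v (f i + (\<lambda>q. \<Sum>i\<in>I. f i q)) = v (f i) + v (\<lambda>q. \<Sum>i\<in>I. f i q)"
    by (intro tangent_add[OF v] smooth_functions_sum) auto
  with insert show ?case by (simp add: plus_fun_def)
qed (simp_all add: tangent_const[OF v])

text \<open>For a bump function \<rho> supported in N, the products of \<rho> with f and with g are
  equal as global functions. Applying v and the product rule at p, where \<rho> is 1, leaves v f and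
  v g plus the same multiple of \<open>v \<rho>\<close>.\<close>

lemma tangent_local:
  assumes v: "v \<in> tangent_space M p" and fg: "f \<in> smooth_functions M" "g \<in> smooth_functions M"
    and N: "openin (mtop M) N" "p \<in> N" "\<And>q. q \<in> N \<Longrightarrow> f q = g q"
  shows "v f = v g"
proof -
  obtain \<rho> where \<rho>: "\<rho> \<in> smooth_functions M" "\<rho> p = 1" "\<And>q. q \<notin> N \<Longrightarrow> \<rho> q = 0"
    by (rule bump_function[OF N(1,2)]) blast
  have "\<rho> * f = \<rho> * g"
    using N(3) \<rho>(3) by (fastforce simp: fun_eq_iff)
  moreover have "v (\<rho> * f) = v f + f p * v \<rho>" "v (\<rho> * g) = v g + g p * v \<rho>"
    using tangent_mult[OF v \<rho>(1) fg(1)] tangent_mult[OF v \<rho>(1) fg(2)] \<rho>(2) by simp_all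
  ultimately show ?thesis
    using N(3)[OF N(2)] by simp
qed

lemma tangent_space_zero: "0 \<in> tangent_space M p"
  by (simp add: tangent_space_def)

lemma tangent_space_add: "v \<in> tangent_space M p \<Longrightarrow> w \<in> tangent_space M p \<Longrightarrow> v + w \<in> tangent_space M p"
  by (simp add: tangent_space_def algebra_simps)

lemma tangent_space_tscale: "v \<in> tangent_space M p \<Longrightarrow> tscale c v \<in> tangent_space M p"
  by (simp add: tangent_space_def tscale_def algebra_simps)

lemma tangent_space_sum:
  "(\<And>i. i \<in> I \<Longrightarrow> v i \<in> tangent_space M p) \<Longrightarrow> (\<Sum>i\<in>I. v i) \<in> tangent_space M p"
  by (induction I rule: infinite_finite_induct) (auto intro: tangent_space_zero tangent_space_add)

lemma tangent_space_diff:
  assumes "v \<in> tangent_space M p" "w \<in> tangent_space M p"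
  shows "v - w \<in> tangent_space M p"
proof -
  have "v - w = v + tscale (-1) w"
    by (simp add: fun_eq_iff tscale_def)
  then show ?thesis
    using tangent_space_add[OF assms(1) tangent_space_tscale[OF assms(2)]] by metis
qed

end

lemma sum_fun_apply: "(\<Sum>i\<in>I. f i) x = (\<Sum>i\<in>I. f i x)"
  by (induction I rule: infinite_finite_induct) auto

context smooth_mfd
begin

section \<open>Vector fields as a module over the smooth functions\<close>

lemma vector_fields_iff:
  "X \<in> vector_fields M \<longleftrightarrow> (\<forall>p\<in>points M. X p \<in> tangent_space M p) \<and> (\<forall>p. p \<notin> points M \<longrightarrow> X p = 0) \<and>
     (\<forall>f\<in>smooth_functions M. vapply X f \<in> smooth_functions M)"
  by (simp add: vector_fields_def)

lemma vector_field_tangent: "X \<in> vector_fields M \<Longrightarrow> p \<in> points M \<Longrightarrow> X p \<in> tangent_space M p"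
  by (simp add: vector_fields_def)

lemma vector_field_off: "X \<in> vector_fields M \<Longrightarrow> p \<notin> points M \<Longrightarrow> X p = 0"
  by (simp add: vector_fields_def)

lemma vector_field_smooth: "X \<in> vector_fields M \<Longrightarrow> f \<in> smooth_functions M \<Longrightarrow> vapply X f \<in> smooth_functions M"
  by (simp add: vector_fields_def)

lemma vector_fields_zero: "0 \<in> vector_fields M"
  using smooth_functions_const[of 0]
  by (simp add: vector_fields_def tangent_space_zero vapply_def)

lemma vector_fields_add:
  assumes "X \<in> vector_fields M" "Y \<in> vector_fields M"
  shows "X + Y \<in> vector_fields M"
proof -
  have "vapply (X + Y) f = vapply X f + vapply Y f" for f
    by (simp add: vapply_def fun_eq_iff)
  with assms show ?thesis
    by (simp add: vector_fields_def tangent_space_add smooth_functions_add)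
qed

lemma vector_fields_vscale:
  assumes "f \<in> smooth_functions M" "X \<in> vector_fields M"
  shows "vscale f X \<in> vector_fields M"
proof -
  have "vapply (vscale f X) g = f * vapply X g" for g
    by (simp add: vapply_def vscale_def tscale_def fun_eq_iff)
  moreover have "tscale c 0 = (0 :: 'a tvec)" for c
    by (simp add: tscale_def fun_eq_iff)
  ultimately show ?thesis
    using assms by (simp add: vector_fields_def tangent_space_tscale smooth_functions_mult vscale_def)
qed

lemma vector_fields_sum:
  "(\<And>i. i \<in> I \<Longrightarrow> X i \<in> vector_fields M) \<Longrightarrow> (\<Sum>i\<in>I. X i) \<in> vector_fields M"
  by (induction I rule: infinite_finite_induct) (auto intro: vector_fields_zero vector_fields_add)

context
  fixes U \<phi>
  assumes chart: "(U, \<phi>) \<in> atlas M"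
begin

lemma smooth_in_chart: "f \<in> smooth_functions M \<Longrightarrow> smooth_on (\<phi> ` U) (f \<circ> inv_into U \<phi>)"
  using chart unfolding smooth_functions_def by blast

lemma chart_has_derivative:
  "f \<in> smooth_functions M \<Longrightarrow> q \<in> U \<Longrightarrow>
     (f \<circ> inv_into U \<phi> has_derivative frechet_derivative (f \<circ> inv_into U \<phi>) (at (\<phi> q))) (at (\<phi> q))"
  using smooth_on_differentiable[OF smooth_in_chart, of f "\<phi> q"] by (simp add: frechet_derivative_works)

text \<open>This is c times the i-th coordinate derivation at q. The scalar c is included because
  the global frame fields are coordinate fields multiplied by a cut-off; the \<open>else\<close>
  branch implements the convention that tangent vectors vanish on non-smooth functions.\<close>

lemma coordinate_vector:
  assumes q: "q \<in> U"
  shows "(\<lambda>f. if f \<in> smooth_functions M then c * frechet_derivative (f \<circ> inv_into U \<phi>) (at (\<phi> q)) i else 0)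
    \<in> tangent_space M q" (is "?v \<in> _")
  unfolding tangent_space_def
proof (intro CollectI conjI ballI allI impI)
  let ?D = "\<lambda>f. frechet_derivative (f \<circ> inv_into U \<phi>) (at (\<phi> q))"
  fix f g assume f: "f \<in> smooth_functions M" and g: "g \<in> smooth_functions M"
  note df = chart_has_derivative[OF f q] and dg = chart_has_derivative[OF g q]
  have "(f + g) \<circ> inv_into U \<phi> = (\<lambda>y. (f \<circ> inv_into U \<phi>) y + (g \<circ> inv_into U \<phi>) y)"
    by (simp add: fun_eq_iff)
  then have "?D (f + g) = (\<lambda>v. ?D f v + ?D g v)"
    using frechet_derivative_at[OF has_derivative_add[OF df dg]] by simp
  then show "?v (f + g) = ?v f + ?v g"
    using f g smooth_functions_add[OF f g] by (simp add: distrib_left)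
  have "(f * g) \<circ> inv_into U \<phi> = (\<lambda>y. (f \<circ> inv_into U \<phi>) y * (g \<circ> inv_into U \<phi>) y)"
    by (simp add: fun_eq_iff)
  then have "?D (f * g) = (\<lambda>v. (f \<circ> inv_into U \<phi>) (\<phi> q) * ?D g v + ?D f v * (g \<circ> inv_into U \<phi>) (\<phi> q))"
    using frechet_derivative_at[OF has_derivative_mult[OF df dg]] by simp
  then show "?v (f * g) = f q * ?v g + g q * ?v f"
    using f g smooth_functions_mult[OF f g] by (simp add: chart_inverse[OF chart q] algebra_simps)
next
  let ?D = "\<lambda>f. frechet_derivative (f \<circ> inv_into U \<phi>) (at (\<phi> q))"
  fix a f assume f: "f \<in> smooth_functions M"
  have "(\<lambda>x. a * f x) \<circ> inv_into U \<phi> = (\<lambda>y. a * (f \<circ> inv_into U \<phi>) y)"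
    by (simp add: fun_eq_iff)
  then have "?D (\<lambda>x. a * f x) = (\<lambda>v. a * ?D f v)"
    using frechet_derivative_at[OF has_derivative_mult_right[OF chart_has_derivative[OF f q], of a]] by simp
  then show "?v (\<lambda>x. a * f x) = a * ?v f"
    using f smooth_functions_cmult[OF f, of a] by simp
qed simp

end

text \<open>Coordinates and coordinate fields of a chart, multiplied by a cut-off, become global
  objects that are unchanged on the set N where the cut-off is 1. That the fields span follows from
  Hadamard's lemma at q: in f = f(q) + sum of (x_i - x_i(q)) g_i, a derivation at q kills the
  constant and sees only v(x_i) g_i(q), where g_i(q) is the i-th partial derivative of f.\<close>

lemma local_frame:
  assumes "p \<in> points M"
  obtains N and x :: "'e \<Rightarrow> 'a \<Rightarrow> real" and E :: "'e \<Rightarrow> 'a vfield"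
  where "openin (mtop M) N" "p \<in> N" "\<And>i. x i \<in> smooth_functions M" "\<And>i. E i \<in> vector_fields M"
    "\<And>q i j. q \<in> N \<Longrightarrow> i \<in> Basis \<Longrightarrow> j \<in> Basis \<Longrightarrow> E i q (x j) = (if i = j then 1 else 0)"
    "\<And>q v. q \<in> N \<Longrightarrow> v \<in> tangent_space M q \<Longrightarrow> v = (\<Sum>i\<in>Basis. tscale (v (x i)) (E i q))"
proof -
  obtain U \<phi> where c: "(U, \<phi>) \<in> atlas M" and pU: "p \<in> U"
    using assms by (rule chart_at)
  note UM = chart_subset[OF c] and inv = chart_inverse[OF c]
  obtain e where e: "e > 0" "ball (\<phi> p) e \<subseteq> \<phi> ` U"
    using chart_properties(2)[OF c] pU by (meson imageI open_contains_ball)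
  \<comment> \<open>A third of e leaves room for the closed ball of radius 2 r, outside which the
    cut-off vanishes, to lie inside the open ball C. A ball is taken for C because Hadamard's lemma
    needs convexity.\<close>
  define r where "r = e / 3"
  have r: "r > 0" "2 * r < e" using e(1) by (auto simp: r_def)
  obtain \<rho> :: "'e \<Rightarrow> real" where \<rho>: "smooth_on UNIV \<rho>" "\<And>x. x \<in> ball (\<phi> p) r \<Longrightarrow> \<rho> x = 1"
    "\<And>x. x \<notin> cball (\<phi> p) (2 * r) \<Longrightarrow> \<rho> x = 0"
    using smooth_bump_euclidean[OF r(1), of "\<phi> p"] by metis
  define C where "C = ball (\<phi> p) e"
  have C: "open C" "convex C" "C \<subseteq> \<phi> ` U" using e by (auto simp: C_def)
  have rC: "ball (\<phi> p) r \<subseteq> C" "cball (\<phi> p) (2 * r) \<subseteq> C"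
    using r by (auto simp: C_def)
  \<comment> \<open>Turns any function that is smooth on C into a global smooth function which
    agrees with it in the chart over N. The coordinates, the components of the frame fields and the
    Hadamard factors all go through it.\<close>
  define ext where "ext g q = (if q \<in> U then \<rho> (\<phi> q) * g (\<phi> q) else 0)" for g q
  have ext: "ext g \<in> smooth_functions M" if "smooth_on C g" for g
    using smooth_extension_by_zero[OF c C(1,3) compact_cball rC(2) \<rho>(1,3) that]
    by (simp add: ext_def[abs_def])
  define N where "N = {q \<in> U. \<phi> q \<in> ball (\<phi> p) r}"
  have N: "openin (mtop M) N"
    unfolding N_def by (rule openin_chart_vimage[OF c open_ball])
  have NU: "q \<in> U" "\<phi> q \<in> ball (\<phi> p) r" "\<phi> q \<in> C" "\<rho> (\<phi> q) = 1" if "q \<in> N" for q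
    using that rC(1) \<rho>(2) by (auto simp: N_def)
  have extN: "ext g q = g (\<phi> q)" if "q \<in> N" for g q
    using NU[OF that] by (simp add: ext_def)
  define x where "x i = ext (\<lambda>y. y \<bullet> i)" for i
  have x: "x i \<in> smooth_functions M" for i
    unfolding x_def by (intro ext smooth_on_bounded_linear[OF bounded_linear_inner_left C(1) smooth_on_id[OF C(1)]])
  define E where "E i q = (\<lambda>f. if q \<in> U \<and> f \<in> smooth_functions M
     then \<rho> (\<phi> q) * frechet_derivative (f \<circ> inv_into U \<phi>) (at (\<phi> q)) i else 0)" for i q
  have E: "E i \<in> vector_fields M" for i
    unfolding vector_fields_iff
  proof (intro conjI ballI allI impI)
    show "E i q \<in> tangent_space M q" if "q \<in> points M" for q
    proof (cases "q \<in> U")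
      case True
      then show ?thesis
        using coordinate_vector[OF c True, of "\<rho> (\<phi> q)" i] by (simp add: E_def)
    next
      case False
      then have "E i q = 0" by (simp add: E_def fun_eq_iff)
      then show ?thesis by (simp add: tangent_space_zero)
    qed
    show "E i q = 0" if "q \<notin> points M" for q
      using that UM by (auto simp: E_def fun_eq_iff)
    fix f assume f: "f \<in> smooth_functions M"
    have "vapply (E i) f = ext (\<lambda>y. frechet_derivative (f \<circ> inv_into U \<phi>) (at y) i)"
      using f by (simp add: vapply_def E_def ext_def fun_eq_iff)
    moreover have "smooth_on C (\<lambda>y. frechet_derivative (f \<circ> inv_into U \<phi>) (at y) i)"
      by (rule smooth_on_frechet_derivative[OF smooth_on_subset[OF smooth_in_chart[OF c f] C(3)]])
    ultimately show "vapply (E i) f \<in> smooth_functions M"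
      using ext by simp
  qed
  have delta: "E i q (x j) = (if i = j then 1 else 0)" if q: "q \<in> N" and ij: "i \<in> Basis" "j \<in> Basis" for q i j
  proof -
    have "(x j \<circ> inv_into U \<phi> has_derivative (\<lambda>v. v \<bullet> j)) (at (\<phi> q))"
    proof (rule has_derivative_transform_within_open[of "\<lambda>y. y \<bullet> j" _ _ UNIV "ball (\<phi> p) r"])
      show "((\<lambda>y. y \<bullet> j) has_derivative (\<lambda>v. v \<bullet> j)) (at (\<phi> q))"
        by (rule bounded_linear_imp_has_derivative[OF bounded_linear_inner_left])
      fix y assume y: "y \<in> ball (\<phi> p) r"
      then obtain m where "m \<in> U" "y = \<phi> m" using rC(1) C(3) by blast
      then show "y \<bullet> j = (x j \<circ> inv_into U \<phi>) y"
        using y extN[of m "\<lambda>y. y \<bullet> j"] by (simp add: x_def inv N_def)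
    qed (use NU[OF q] in auto)
    from frechet_derivative_at[OF this]
    have "frechet_derivative (x j \<circ> inv_into U \<phi>) (at (\<phi> q)) i = i \<bullet> j" by metis
    then show ?thesis
      using NU[OF q] x ij by (simp add: E_def inner_Basis)
  qed
  have span: "v = (\<Sum>i\<in>Basis. tscale (v (x i)) (E i q))" if q: "q \<in> N" and v: "v \<in> tangent_space M q" for q v
  proof
    fix f
    show "v f = (\<Sum>i\<in>Basis. tscale (v (x i)) (E i q)) f"
    proof (cases "f \<in> smooth_functions M")
      case False
      then show ?thesis
        by (simp add: sum_fun_apply tscale_def E_def tangent_not_smooth[OF v])
    next
      case f: True
      let ?F = "f \<circ> inv_into U \<phi>"
      obtain g where g': "(\<forall>i. smooth_on C (g i)) \<and>
          (\<forall>i. g i (\<phi> q) = frechet_derivative ?F (at (\<phi> q)) i) \<and>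
          (\<forall>y\<in>C. ?F y = ?F (\<phi> q) + (\<Sum>i\<in>Basis. ((y - \<phi> q) \<bullet> i) * g i y))"
        using hadamard[OF C(2,1) NU(3)[OF q] smooth_on_subset[OF smooth_in_chart[OF c f] C(3)]]
        by (rule exE)
      note g = g'[THEN conjunct1, rule_format] g'[THEN conjunct2, THEN conjunct1, rule_format]
        g'[THEN conjunct2, THEN conjunct2, rule_format]
      \<comment> \<open>The coordinates recentred at q, not at p: they vanish at q, so the product
        rule drops the term that would involve the derivative of the Hadamard factor.\<close>
      define y where "y i m = x i m - \<phi> q \<bullet> i" for i m
      have "y i = x i - (\<lambda>_. \<phi> q \<bullet> i)" for i by (simp add: y_def fun_eq_iff)
      then have y: "y i \<in> smooth_functions M" "v (y i) = v (x i)" for i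
        using smooth_functions_diff[OF x smooth_functions_const] tangent_diff[OF v x smooth_functions_const]
        by (simp_all add: tangent_const[OF v])
      have yG: "y i * ext (g i) \<in> smooth_functions M" for i
        by (intro smooth_functions_mult y ext g)
      \<comment> \<open>The expansion of f is valid on N only, since outside N the cut-off distorts
        both factors; locality of derivations makes that sufficient.\<close>
      have "v f = v ((\<lambda>_. f q) + (\<lambda>m. \<Sum>i\<in>Basis. (y i * ext (g i)) m))"
      proof (rule tangent_local[OF v f _ N q])
        show "(\<lambda>_. f q) + (\<lambda>m. \<Sum>i\<in>Basis. (y i * ext (g i)) m) \<in> smooth_functions M"
          by (intro smooth_functions_add smooth_functions_const smooth_functions_sum yG)
        fix m assume m: "m \<in> N"
        show "f m = ((\<lambda>_. f q) + (\<lambda>m. \<Sum>i\<in>Basis. (y i * ext (g i)) m)) m"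
          using g(3)[OF NU(3)[OF m]] NU(1)[OF m] NU(1)[OF q]
          by (simp add: extN[OF m] y_def x_def inv inner_diff_left)
      qed
      also have "\<dots> = v (\<lambda>_. f q) + v (\<lambda>m. \<Sum>i\<in>Basis. (y i * ext (g i)) m)"
        by (intro tangent_add[OF v] smooth_functions_const smooth_functions_sum yG)
      also have "\<dots> = (\<Sum>i\<in>Basis. v (y i * ext (g i)))"
        by (simp only: tangent_const[OF v] tangent_sum[OF v yG] add_0)
      also have "\<dots> = (\<Sum>i\<in>Basis. v (x i) * E i q f)"
      proof (rule sum.cong[OF refl])
        fix i
        have "v (y i * ext (g i)) = y i q * v (ext (g i)) + ext (g i) q * v (y i)"
          by (intro tangent_mult[OF v] y ext g)
        moreover have "y i q = 0"
          by (simp add: y_def x_def extN[OF q])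
        moreover have "ext (g i) q = E i q f"
          using NU[OF q] f by (simp add: extN[OF q] g(2) E_def)
        ultimately show "v (y i * ext (g i)) = v (x i) * E i q f"
          by (simp only: y(2) mult_zero_left add_0 mult.commute)
      qed
      finally show ?thesis
        by (simp add: sum_fun_apply tscale_def)
    qed
  qed
  have "p \<in> N"
    using pU r by (simp add: N_def)
  show ?thesis
    by (rule that[of N x E, OF N \<open>p \<in> N\<close> x E delta span])
qed

text \<open>The coefficients of w in a local frame at p are kept as constants; the frame fields are
  already global.\<close>

lemma vector_field_extension:
  assumes "p \<in> points M" "w \<in> tangent_space M p"
  obtains W where "W \<in> vector_fields M" "W p = w"
proof -
  obtain N and x :: "'e \<Rightarrow> 'a \<Rightarrow> real" and E where fr: "openin (mtop M) N" "p \<in> N" "\<And>i. E i \<in> vector_fields M"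
    "\<And>q v. q \<in> N \<Longrightarrow> v \<in> tangent_space M q \<Longrightarrow> v = (\<Sum>i\<in>Basis. tscale (v (x i)) (E i q))"
    using assms(1) by (rule local_frame) blast
  show ?thesis
  proof
    show "(\<Sum>i\<in>Basis. vscale (\<lambda>_. w (x i)) (E i)) \<in> vector_fields M"
      by (intro vector_fields_sum vector_fields_vscale smooth_functions_const fr(3))
    show "(\<Sum>i\<in>Basis. vscale (\<lambda>_. w (x i)) (E i)) p = w"
      using fr(4)[OF fr(2) assms(2)] by (simp add: sum_fun_apply vscale_def)
  qed
qed

section \<open>Tensoriality\<close>

text \<open>Linearity over the smooth functions, the section-level description of a 1-form.
  Vanishing outside \<open>points M\<close> is included so that such a functional can equal
  \<open>fapply \<gamma>\<close> as a HOL function.\<close>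

definition tensorial :: "('a vfield \<Rightarrow> 'a \<Rightarrow> real) \<Rightarrow> bool" where
  "tensorial L \<longleftrightarrow>
     (\<forall>X\<in>vector_fields M. \<forall>Y\<in>vector_fields M. L (X + Y) = L X + L Y) \<and>
     (\<forall>f\<in>smooth_functions M. \<forall>X\<in>vector_fields M. L (vscale f X) = f * L X) \<and>
     (\<forall>X\<in>vector_fields M. L X \<in> smooth_functions M \<and> (\<forall>p. p \<notin> points M \<longrightarrow> L X p = 0))"

lemma tensorial_zero:
  assumes "tensorial L"
  shows "L 0 = 0"
proof -
  have "vscale 0 0 = (0 :: 'a vfield)"
    by (simp add: vscale_def tscale_def fun_eq_iff)
  moreover have "L (vscale 0 0) = 0 * L 0"
    using assms smooth_functions_const[of 0] vector_fields_zero by (simp add: tensorial_def zero_fun_def[symmetric])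
  ultimately show ?thesis by simp
qed

lemma tensorial_sum:
  assumes L: "tensorial L" and "\<And>i. i \<in> I \<Longrightarrow> X i \<in> vector_fields M"
  shows "L (\<Sum>i\<in>I. X i) = (\<Sum>i\<in>I. L (X i))"
  using assms(2)
proof (induction I rule: infinite_finite_induct)
  case (insert i I)
  then have "L (X i + (\<Sum>i\<in>I. X i)) = L (X i) + L (\<Sum>i\<in>I. X i)"
    using L vector_fields_sum[of I X] by (simp add: tensorial_def)
  with insert show ?case by (simp only: sum.insert insert_iff simp_thms)
qed (simp_all add: tensorial_zero[OF L])

text \<open>With a bump function \<rho> supported in the frame neighbourhood, \<rho> X is globally
  the sum of \<rho> X(x_i) E_i. Applying L and evaluating at p, every coefficient X(x_i) is 0 there,
  while the left side is L X at p because \<rho> is 1 at p.\<close>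

lemma tensorial_vanish:
  assumes L: "tensorial L" and X: "X \<in> vector_fields M" and p: "p \<in> points M" "X p = 0"
  shows "L X p = 0"
proof -
  obtain N and x :: "'e \<Rightarrow> 'a \<Rightarrow> real" and E where fr: "openin (mtop M) N" "p \<in> N"
    "\<And>i. x i \<in> smooth_functions M" "\<And>i. E i \<in> vector_fields M"
    "\<And>q v. q \<in> N \<Longrightarrow> v \<in> tangent_space M q \<Longrightarrow> v = (\<Sum>i\<in>Basis. tscale (v (x i)) (E i q))"
    using p(1) by (rule local_frame) blast
  obtain \<rho> where \<rho>: "\<rho> \<in> smooth_functions M" "\<rho> p = 1" "\<And>q. q \<notin> N \<Longrightarrow> \<rho> q = 0"
    by (rule bump_function[OF fr(1,2)]) blast
  have NM: "N \<subseteq> points M" using fr(1) by (rule openin_subset)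
  have c: "\<rho> * vapply X (x i) \<in> smooth_functions M" for i
    by (intro smooth_functions_mult \<rho>(1) vector_field_smooth[OF X] fr(3))
  have "vscale \<rho> X = (\<Sum>i\<in>Basis. vscale (\<rho> * vapply X (x i)) (E i))"
  proof
    fix q
    show "vscale \<rho> X q = (\<Sum>i\<in>Basis. vscale (\<rho> * vapply X (x i)) (E i)) q"
    proof (cases "q \<in> N")
      case True
      with NM have "X q \<in> tangent_space M q"
        by (intro vector_field_tangent[OF X]) auto
      note Xq = fun_cong[OF fr(5)[OF True this]]
      show ?thesis
      proof
        fix f
        show "vscale \<rho> X q f = (\<Sum>i\<in>Basis. vscale (\<rho> * vapply X (x i)) (E i)) q f"
          using Xq[of f]
          by (simp add: vscale_def tscale_def vapply_def sum_fun_apply sum_distrib_left mult.assoc)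
      qed
    next
      case False
      then show ?thesis
        by (simp add: \<rho>(3) fun_eq_iff vscale_def tscale_def sum_fun_apply)
    qed
  qed
  then have "L (vscale \<rho> X) = (\<Sum>i\<in>Basis. L (vscale (\<rho> * vapply X (x i)) (E i)))"
    using tensorial_sum[OF L vector_fields_vscale[OF c fr(4)]] by simp
  moreover have "L (vscale \<rho> X) = \<rho> * L X"
    using L \<rho>(1) X by (simp add: tensorial_def)
  moreover have "L (vscale (\<rho> * vapply X (x i)) (E i)) = \<rho> * vapply X (x i) * L (E i)" for i
    using L c[of i] fr(4) by (simp add: tensorial_def)
  ultimately have "(\<rho> * L X) p = (\<Sum>i\<in>Basis. \<rho> * vapply X (x i) * L (E i)) p" by simp
  then show ?thesis
    using p \<rho>(2) by (simp add: sum_fun_apply vapply_def)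
qed

lemma tensorial_cong:
  assumes L: "tensorial L" and XY: "X \<in> vector_fields M" "Y \<in> vector_fields M"
    and p: "p \<in> points M" "X p = Y p"
  shows "L X p = L Y p"
proof -
  let ?Z = "vscale (\<lambda>_. -1) Y"
  have Z: "?Z \<in> vector_fields M"
    by (rule vector_fields_vscale[OF smooth_functions_const XY(2)])
  have "L (X + ?Z) p = 0"
    by (rule tensorial_vanish[OF L vector_fields_add[OF XY(1) Z] p(1)])
       (simp add: p(2) vscale_def tscale_def fun_eq_iff)
  moreover have "L (X + ?Z) = L X + (\<lambda>_. -1) * L Y"
    using L XY Z smooth_functions_const[of "-1"] by (simp add: tensorial_def)
  ultimately show ?thesis by simp
qed

text \<open>Every tangent vector is the value of a global field, so testing on fields tests all
  tangent vectors; on all other arguments both forms are 0 by convention. It supplies uniqueness for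
  both definite descriptions.\<close>

lemma one_form_ext:
  assumes "\<alpha> \<in> one_forms M" "\<beta> \<in> one_forms M"
    and "\<And>X. X \<in> vector_fields M \<Longrightarrow> fapply \<alpha> X = fapply \<beta> X"
  shows "\<alpha> = \<beta>"
proof (intro ext)
  fix p w
  consider "p \<notin> points M" | "p \<in> points M" "w \<notin> tangent_space M p" | "p \<in> points M" "w \<in> tangent_space M p"
    by blast
  then show "\<alpha> p w = \<beta> p w"
  proof cases
    case 3
    then obtain W where "W \<in> vector_fields M" "W p = w" by (rule vector_field_extension)
    then show ?thesis using fun_cong[OF assms(3), of W p] by (simp add: fapply_def)
  qed (use assms(1,2) in \<open>auto simp: one_forms_def cotangent_space_def\<close>)
qed

lemma tensorial_one_form:
  assumes L: "tensorial L"
  obtains \<gamma> where "\<gamma> \<in> one_forms M" "\<And>X. X \<in> vector_fields M \<Longrightarrow> fapply \<gamma> X = L X"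
proof -
  \<comment> \<open>An arbitrary extension of each tangent vector to a field. The resulting value of
    \<gamma> does not depend on it, since L X at p is determined by X p; \<open>eq\<close> records
    this, and linearity of \<gamma> is proved by switching to convenient extensions.\<close>
  define W where "W p w = (SOME X. X \<in> vector_fields M \<and> X p = w)" for p w
  have W: "W p w \<in> vector_fields M" "W p w p = w" if "p \<in> points M" "w \<in> tangent_space M p" for p w
    using someI_ex[of "\<lambda>X. X \<in> vector_fields M \<and> X p = w"] vector_field_extension[OF that]
    unfolding W_def by blast+
  define \<gamma> where "\<gamma> p w = (if p \<in> points M \<and> w \<in> tangent_space M p then L (W p w) p else 0)" for p w
  have eq: "\<gamma> p w = L X p" if "p \<in> points M" "X \<in> vector_fields M" "X p = w" for p w X
  proof -
    have w: "w \<in> tangent_space M p" using vector_field_tangent that by blast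
    show ?thesis
      using tensorial_cong[OF L W(1)[OF that(1) w] that(2,1)] W(2)[OF that(1) w] that w by (simp add: \<gamma>_def)
  qed
  have fap: "fapply \<gamma> X = L X" if X: "X \<in> vector_fields M" for X
  proof
    fix p
    show "fapply \<gamma> X p = L X p"
    proof (cases "p \<in> points M")
      case True
      then show ?thesis using eq[OF True X] by (simp add: fapply_def)
    next
      case False
      then show ?thesis using L X by (simp add: fapply_def \<gamma>_def tensorial_def)
    qed
  qed
  have "\<gamma> p \<in> cotangent_space M p" if p: "p \<in> points M" for p
    unfolding cotangent_space_def
  proof (intro CollectI conjI ballI allI impI)
    fix v assume v: "v \<in> tangent_space M p"
    note Wv = W[OF p v]
    show "\<gamma> p (v + w) = \<gamma> p v + \<gamma> p w" if w: "w \<in> tangent_space M p" for w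
    proof -
      note Ww = W[OF p w]
      have "\<gamma> p (v + w) = L (W p v + W p w) p"
        by (rule eq[OF p vector_fields_add[OF Wv(1) Ww(1)]]) (simp add: Wv Ww)
      also have "\<dots> = L (W p v) p + L (W p w) p"
        using L Wv(1) Ww(1) by (simp add: tensorial_def)
      finally show ?thesis using p v w by (simp add: \<gamma>_def)
    qed
    show "\<gamma> p (tscale c v) = c * \<gamma> p v" for c
    proof -
      have "\<gamma> p (tscale c v) = L (vscale (\<lambda>_. c) (W p v)) p"
        by (rule eq[OF p vector_fields_vscale[OF smooth_functions_const Wv(1)]]) (simp add: Wv vscale_def)
      also have "\<dots> = c * L (W p v) p"
        using L Wv(1) smooth_functions_const[of c] by (simp add: tensorial_def)
      finally show ?thesis using p v by (simp add: \<gamma>_def)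
    qed
  qed (simp add: \<gamma>_def)
  moreover have "\<gamma> p = 0" if "p \<notin> points M" for p
    using that by (simp add: \<gamma>_def fun_eq_iff)
  moreover have "fapply \<gamma> X \<in> smooth_functions M" if "X \<in> vector_fields M" for X
    using L that fap by (simp add: tensorial_def)
  ultimately have "\<gamma> \<in> one_forms M"
    by (simp add: one_forms_def)
  then show ?thesis using fap by (rule that)
qed

end

section \<open>The inverse of a non-degenerate tensor\<close>

text \<open>A type indexing the standard basis, so that determinants and Cramer's rule apply.\<close>

typedef (overloaded) 'e basis_index = "Basis :: 'e::euclidean_space set"
  morphisms basis_vec Basis_index
  using nonempty_Basis by blast

lemma bij_betw_basis_vec: "bij_betw basis_vec UNIV (Basis :: 'e::euclidean_space set)"
  by (metis type_definition.Rep_range type_definition_basis_index basis_vec_inject injI inj_on_imp_bij_betw)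

instance basis_index :: (euclidean_space) finite
  by standard (metis bij_betw_finite bij_betw_basis_vec finite_Basis)

lemma sum_basis_index:
  "(\<Sum>i\<in>(UNIV :: 'e::euclidean_space basis_index set). F (basis_vec i)) = (\<Sum>b\<in>Basis. F b)"
  by (rule sum.reindex_bij_betw[OF bij_betw_basis_vec])

context smooth_mfd
begin

lemma smooth_fun_on_det:
  fixes A :: "'a \<Rightarrow> real^'n^'n"
  assumes "openin (mtop M) N" "\<And>i j. smooth_fun_on M N (\<lambda>q. A q $ i $ j)"
  shows "smooth_fun_on M N (\<lambda>q. det (A q))"
  unfolding det_def
  by (intro smooth_fun_on_sum smooth_fun_on_mult smooth_fun_on_prod smooth_fun_on_const assms)

section \<open>Pointwise linear algebra of covectors and bilinear forms\<close>

lemma cotangent_add: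
  "\<omega> \<in> cotangent_space M p \<Longrightarrow> v \<in> tangent_space M p \<Longrightarrow> w \<in> tangent_space M p \<Longrightarrow> \<omega> (v + w) = \<omega> v + \<omega> w"
  by (simp add: cotangent_space_def)

lemma cotangent_tscale:
  "\<omega> \<in> cotangent_space M p \<Longrightarrow> v \<in> tangent_space M p \<Longrightarrow> \<omega> (tscale c v) = c * \<omega> v"
  by (simp add: cotangent_space_def)

lemma cotangent_off: "\<omega> \<in> cotangent_space M p \<Longrightarrow> v \<notin> tangent_space M p \<Longrightarrow> \<omega> v = 0"
  by (simp add: cotangent_space_def)

lemma cotangent_zero:
  assumes "\<omega> \<in> cotangent_space M p"
  shows "\<omega> 0 = 0"
proof -
  have "tscale 0 0 = (0 :: 'a tvec)"
    by (simp add: tscale_def fun_eq_iff)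
  then show ?thesis
    using cotangent_tscale[OF assms tangent_space_zero, of 0] by simp
qed

lemma cotangent_diff:
  assumes "\<omega> \<in> cotangent_space M p" "v \<in> tangent_space M p" "w \<in> tangent_space M p"
  shows "\<omega> (v - w) = \<omega> v - \<omega> w"
proof -
  have "v - w = v + tscale (-1) w"
    by (simp add: fun_eq_iff tscale_def)
  then have "\<omega> (v - w) = \<omega> v + \<omega> (tscale (-1) w)"
    using cotangent_add[OF assms(1,2) tangent_space_tscale[OF assms(3)]] by metis
  then show ?thesis
    using cotangent_tscale[OF assms(1,3), of "-1"] by simp
qed

lemma cotangent_sum:
  assumes \<omega>: "\<omega> \<in> cotangent_space M p" and v: "\<And>i. i \<in> I \<Longrightarrow> v i \<in> tangent_space M p"
  shows "\<omega> (\<Sum>i\<in>I. tscale (c i) (v i)) = (\<Sum>i\<in>I. c i * \<omega> (v i))"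
  using v
proof (induction I rule: infinite_finite_induct)
  case (insert i I)
  then have "\<omega> (tscale (c i) (v i) + (\<Sum>i\<in>I. tscale (c i) (v i)))
      = \<omega> (tscale (c i) (v i)) + \<omega> (\<Sum>i\<in>I. tscale (c i) (v i))"
    by (intro cotangent_add[OF \<omega>] tangent_space_tscale tangent_space_sum) auto
  with insert cotangent_tscale[OF \<omega>] show ?case
    by (simp only: sum.insert insert_iff simp_thms)
qed (simp_all add: cotangent_zero[OF \<omega>])

lemma one_form_cotangent: "\<alpha> \<in> one_forms M \<Longrightarrow> p \<in> points M \<Longrightarrow> \<alpha> p \<in> cotangent_space M p"
  by (simp add: one_forms_def)

lemma one_form_off: "\<alpha> \<in> one_forms M \<Longrightarrow> p \<notin> points M \<Longrightarrow> \<alpha> p = 0"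
  by (simp add: one_forms_def)

lemma one_form_smooth: "\<alpha> \<in> one_forms M \<Longrightarrow> X \<in> vector_fields M \<Longrightarrow> fapply \<alpha> X \<in> smooth_functions M"
  by (simp add: one_forms_def)

lemma tensor2_cotangent:
  assumes "h \<in> tensor_fields2 M" "p \<in> points M" "v \<in> tangent_space M p"
  shows "h p v \<in> cotangent_space M p" "(\<lambda>w. h p w v) \<in> cotangent_space M p"
  using assms by (simp_all add: tensor_fields2_def)

lemma tensor2_off: "h \<in> tensor_fields2 M \<Longrightarrow> p \<notin> points M \<Longrightarrow> h p v w = 0"
  by (simp add: tensor_fields2_def)

lemma tensor2_smooth:
  "h \<in> tensor_fields2 M \<Longrightarrow> X \<in> vector_fields M \<Longrightarrow> Y \<in> vector_fields M \<Longrightarrow> tapply h X Y \<in> smooth_functions M"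
  by (simp add: tensor_fields2_def)

text \<open>Non-degeneracy says that the kernel is trivial, and linearity in the first slot upgrades
  this to injectivity. Hence \<open>inv_into\<close> in \<open>sharp\<close> recovers any preimage
  that is known to exist; existence comes from the matrix argument that follows.\<close>

lemma tensor2_inj_on:
  assumes h: "h \<in> tensor_fields2 M" "nondegenerate M h" and p: "p \<in> points M"
  shows "inj_on (h p) (tangent_space M p)"
proof
  fix v w assume vw: "v \<in> tangent_space M p" "w \<in> tangent_space M p" "h p v = h p w"
  have "h p (v - w) u = 0" if "u \<in> tangent_space M p" for u
    using cotangent_diff[OF tensor2_cotangent(2)[OF h(1) p that] vw(1,2)] vw(3) by simp
  then have "v - w = 0"
    using h(2) p tangent_space_diff[OF vw(1,2)] unfolding nondegenerate_def by blast
  then show "v = w" by (simp add: fun_eq_iff)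
qed

text \<open>In a local frame, \<open>\<beta> = h(Z, \<cdot>)\<close> is a linear system with invertible matrix, and Cramer's rule
  shows that its solution depends smoothly on the point.\<close>

lemma local_sharp:
  assumes h: "h \<in> tensor_fields2 M" "nondegenerate M h" and \<beta>: "\<beta> \<in> one_forms M" and p: "p \<in> points M"
  obtains N and z :: "'e basis_index \<Rightarrow> 'a \<Rightarrow> real" and E :: "'e basis_index \<Rightarrow> 'a vfield"
  where "openin (mtop M) N" "p \<in> N" "\<And>i. smooth_fun_on M N (z i)" "\<And>i. E i \<in> vector_fields M"
    "\<And>q. q \<in> N \<Longrightarrow> h q (\<Sum>i\<in>UNIV. tscale (z i q) (E i q)) = \<beta> q"
proof -
  obtain N and x0 :: "'e \<Rightarrow> 'a \<Rightarrow> real" and E0 where N: "openin (mtop M) N" "p \<in> N"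
    and E0: "\<And>i. E0 i \<in> vector_fields M"
    and delta0: "\<And>q i j. q \<in> N \<Longrightarrow> i \<in> Basis \<Longrightarrow> j \<in> Basis \<Longrightarrow> E0 i q (x0 j) = (if i = j then 1 else 0)"
    and span0: "\<And>q v. q \<in> N \<Longrightarrow> v \<in> tangent_space M q \<Longrightarrow> v = (\<Sum>i\<in>Basis. tscale (v (x0 i)) (E0 i q))"
    using p by (rule local_frame) blast
  have NM: "q \<in> points M" if "q \<in> N" for q
    using openin_subset[OF N(1)] that by blast
  define x where "x i = x0 (basis_vec i)" for i :: "'e basis_index"
  define E where "E i = E0 (basis_vec i)" for i :: "'e basis_index"
  have E: "E i \<in> vector_fields M" for i
    by (simp add: E_def E0)
  have ET: "E i q \<in> tangent_space M q" if "q \<in> N" for i q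
    by (rule vector_field_tangent[OF E NM[OF that]])
  have delta: "E i q (x j) = (if i = j then 1 else 0)" if "q \<in> N" for q i j
    using delta0[OF that basis_vec basis_vec] by (simp add: E_def x_def basis_vec_inject)
  have span: "v = (\<Sum>i\<in>UNIV. tscale (v (x i)) (E i q))" if "q \<in> N" "v \<in> tangent_space M q" for q v
  proof -
    have "(\<Sum>i\<in>UNIV. tscale (v (x i)) (E i q)) = (\<Sum>b\<in>Basis. tscale (v (x0 b)) (E0 b q))"
      unfolding E_def x_def by (rule sum_basis_index)
    from span0[OF that, folded this] show ?thesis .
  qed
  \<comment> \<open>The row index j belongs to the second slot of h, so that row j of the system B z
    = b reads h(Z, E_j) = \<beta>(E_j) for Z with coefficients z. This order matters as h need not
    be symmetric.\<close>
  define B :: "'a \<Rightarrow> real^'e basis_index^'e basis_index" where "B q = (\<chi> j i. h q (E i q) (E j q))" for q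
  define b :: "'a \<Rightarrow> real^'e basis_index" where "b q = (\<chi> j. \<beta> q (E j q))" for q
  have Bz: "h q (\<Sum>i\<in>UNIV. tscale (c $ i) (E i q)) (E j q) = (B q *v c) $ j" if q: "q \<in> N" for q c j
    using cotangent_sum[OF tensor2_cotangent(2)[OF h(1) NM[OF q] ET[OF q]], of UNIV "\<lambda>i. E i q" "\<lambda>i. c $ i"]
    by (simp add: ET[OF q] B_def matrix_vector_mult_def mult.commute)
  have form_eq: "\<omega> = \<omega>'" if q: "q \<in> N" and \<omega>: "\<omega> \<in> cotangent_space M q" "\<omega>' \<in> cotangent_space M q"
    and eq: "\<And>j. \<omega> (E j q) = \<omega>' (E j q)" for q \<omega> \<omega>'
  proof
    fix v
    show "\<omega> v = \<omega>' v"
    proof (cases "v \<in> tangent_space M q")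
      case True
      have "\<omega> (\<Sum>i\<in>UNIV. tscale (v (x i)) (E i q)) = \<omega>' (\<Sum>i\<in>UNIV. tscale (v (x i)) (E i q))"
        using cotangent_sum[OF \<omega>(1), of UNIV "\<lambda>i. E i q"] cotangent_sum[OF \<omega>(2), of UNIV "\<lambda>i. E i q"]
        by (simp add: ET[OF q] eq)
      then show ?thesis
        unfolding span[OF q True, symmetric] .
    next
      case False
      then show ?thesis using \<omega> by (simp add: cotangent_off)
    qed
  qed
  have sumT: "(\<Sum>i\<in>UNIV. tscale (c i) (E i q)) \<in> tangent_space M q" if "q \<in> N" for c q
    by (intro tangent_space_sum tangent_space_tscale ET that)
  \<comment> \<open>A kernel vector c of B gives a tangent vector w with coefficients c and h(w,
    E_j) = 0 for all j. Then h(w, .) = 0 because a covector is determined by its values on the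
    frame; so w = 0, and evaluating w on the coordinates x_j returns c_j = 0.\<close>
  have det: "det (B q) \<noteq> 0" if q: "q \<in> N" for q
  proof -
    have "c = 0" if "B q *v c = 0" for c
    proof -
      let ?w = "\<Sum>i\<in>UNIV. tscale (c $ i) (E i q)"
      have "h q ?w = h q 0"
        by (rule form_eq[OF q tensor2_cotangent(1)[OF h(1) NM[OF q] sumT[OF q]]
              tensor2_cotangent(1)[OF h(1) NM[OF q] tangent_space_zero]])
           (simp add: Bz[OF q] that cotangent_zero[OF tensor2_cotangent(2)[OF h(1) NM[OF q] ET[OF q]]])
      then have "?w = 0"
        by (rule inj_onD[OF tensor2_inj_on[OF h NM[OF q]] _ sumT[OF q] tangent_space_zero])
      then have "?w (x j) = 0" for j by simp
      then have "c $ j = 0" for j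
        by (simp add: sum_fun_apply tscale_def delta[OF q] if_distrib cong: if_cong)
      then show "c = 0" by (simp add: vec_eq_iff)
    qed
    then show ?thesis
      using matrix_left_invertible_ker[of "B q"] invertible_left_inverse[of "B q"] invertible_det_nz[of "B q"]
      by blast
  qed
  \<comment> \<open>Cramer's quotient, with column k of B replaced by b. Numerator and denominator
    are polynomials in smooth entries, which makes the solution smooth on N.\<close>
  define z where "z k q = det (\<chi> i j. if j = k then b q $ i else B q $ i $ j) * inverse (det (B q))" for k q
  have smB: "smooth_fun_on M N (\<lambda>q. B q $ i $ j)" for i j
    using smooth_fun_on_subset[OF tensor2_smooth[OF h(1) E E, unfolded smooth_functions_iff] openin_subset[OF N(1)]]
    by (simp add: B_def tapply_def)
  have smb: "smooth_fun_on M N (\<lambda>q. b q $ i)" for i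
    using smooth_fun_on_subset[OF one_form_smooth[OF \<beta> E, unfolded smooth_functions_iff] openin_subset[OF N(1)]]
    by (simp add: b_def fapply_def)
  have smdet: "smooth_fun_on M N (\<lambda>q. det (B q))"
    by (rule smooth_fun_on_det[OF N(1) smB])
  have "smooth_fun_on M N (\<lambda>q. (\<chi> i j. if j = k then b q $ i else B q $ i $ j) $ i $ j)" for i j k
    using smB[of i j] smb[of i] by (cases "j = k") simp_all
  then have smz: "smooth_fun_on M N (z k)" for k
    unfolding z_def[abs_def]
    by (intro smooth_fun_on_mult[OF N(1)] smooth_fun_on_det[OF N(1)] smooth_fun_on_inverse[OF N(1) smdet det])
  have sol: "h q (\<Sum>i\<in>UNIV. tscale (z i q) (E i q)) = \<beta> q" if q: "q \<in> N" for q
  proof (rule form_eq[OF q tensor2_cotangent(1)[OF h(1) NM[OF q] sumT[OF q]] one_form_cotangent[OF \<beta> NM[OF q]]])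
    fix j
    have "B q *v (\<chi> k. z k q) = b q"
      using cramer[OF det[OF q], of "\<chi> k. z k q" "b q"] by (simp add: z_def divide_inverse)
    then show "h q (\<Sum>i\<in>UNIV. tscale (z i q) (E i q)) (E j q) = \<beta> q (E j q)"
      using Bz[OF q, of "\<chi> k. z k q" j] by (simp add: b_def)
  qed
  show ?thesis
    using N smz E sol by (rule that)
qed

text \<open>The value of \<open>sharp\<close> at each point is an unspecified preimage, but by
  injectivity it coincides with the local Cramer solution. That solution provides both existence of
  the preimage and smooth dependence on the point.\<close>

lemma
  assumes h: "h \<in> tensor_fields2 M" "nondegenerate M h" and \<beta>: "\<beta> \<in> one_forms M"
  shows sharp_vector_field: "sharp M h \<beta> \<in> vector_fields M"
    and flat_sharp: "flat h (sharp M h \<beta>) = \<beta>"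
proof -
  let ?Z = "sharp M h \<beta>"
  have Z: "?Z q = w" if "q \<in> points M" "w \<in> tangent_space M q" "h q w = \<beta> q" for q w
    using inv_into_f_f[OF tensor2_inj_on[OF h that(1)] that(2)] that by (simp add: sharp_def)
  have sumT: "(\<Sum>i\<in>UNIV. tscale (z i q) (E i q)) \<in> tangent_space M q"
    if "q \<in> points M" "\<And>i. E i \<in> vector_fields M"
    for q and z :: "'e basis_index \<Rightarrow> 'a \<Rightarrow> real" and E :: "'e basis_index \<Rightarrow> 'a vfield"
    by (intro tangent_space_sum tangent_space_tscale vector_field_tangent that)
  have pt: "?Z p \<in> tangent_space M p" "h p (?Z p) = \<beta> p" if p: "p \<in> points M" for p
  proof -
    obtain N and z :: "'e basis_index \<Rightarrow> 'a \<Rightarrow> real" and E where N: "p \<in> N"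
      and E: "\<And>i. E i \<in> vector_fields M"
      and sol: "\<And>q. q \<in> N \<Longrightarrow> h q (\<Sum>i\<in>UNIV. tscale (z i q) (E i q)) = \<beta> q"
      using h \<beta> p by (rule local_sharp) blast
    show "?Z p \<in> tangent_space M p" "h p (?Z p) = \<beta> p"
      using Z[OF p sumT[OF p E, of z] sol[OF N]] sumT[OF p E, of z] sol[OF N] by simp_all
  qed
  show "?Z \<in> vector_fields M"
    unfolding vector_fields_iff
  proof (intro conjI ballI allI impI)
    show "?Z p \<in> tangent_space M p" if "p \<in> points M" for p
      using pt(1)[OF that] .
    show "?Z p = 0" if "p \<notin> points M" for p
      using that by (simp add: sharp_def)
    fix f assume f: "f \<in> smooth_functions M"
    show "vapply ?Z f \<in> smooth_functions M"
      unfolding smooth_functions_iff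
    proof (rule smooth_fun_on_local)
      fix p assume "p \<in> points M"
      with h \<beta> obtain N and z :: "'e basis_index \<Rightarrow> 'a \<Rightarrow> real" and E
        where N: "openin (mtop M) N" "p \<in> N" and z: "\<And>i. smooth_fun_on M N (z i)"
          and E: "\<And>i. E i \<in> vector_fields M"
          and sol: "\<And>q. q \<in> N \<Longrightarrow> h q (\<Sum>i\<in>UNIV. tscale (z i q) (E i q)) = \<beta> q"
        by (rule local_sharp) blast
      have Zq: "?Z q = (\<Sum>i\<in>UNIV. tscale (z i q) (E i q))" if "q \<in> N" for q
      proof -
        have "q \<in> points M" using openin_subset[OF N(1)] that by blast
        from Z[OF this sumT[OF this E, of z] sol[OF that]] show ?thesis .
      qed
      have "smooth_fun_on M N (vapply (E i) f)" for i
        using smooth_fun_on_subset[OF vector_field_smooth[OF E f, unfolded smooth_functions_iff] openin_subset[OF N(1)]] .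
      then have "smooth_fun_on M N (\<lambda>q. \<Sum>i\<in>UNIV. z i q * vapply (E i) f q)"
        by (intro smooth_fun_on_sum smooth_fun_on_mult N z)
      then have "smooth_fun_on M N (vapply ?Z f)"
        by (rule smooth_fun_on_cong[OF N(1)]) (simp add: vapply_def Zq sum_fun_apply tscale_def)
      with N show "\<exists>W. openin (mtop M) W \<and> p \<in> W \<and> smooth_fun_on M W (vapply ?Z f)" by blast
    qed
  qed
  show "flat h ?Z = \<beta>"
  proof
    fix p
    show "flat h ?Z p = \<beta> p"
    proof (cases "p \<in> points M")
      case True
      then show ?thesis using pt(2)[OF True] by (simp add: flat_def)
    next
      case False
      then show ?thesis
        using tensor2_off[OF h(1)] one_form_off[OF \<beta>] by (simp add: flat_def fun_eq_iff)
    qed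
  qed
qed

lemma flat_one_form:
  assumes h: "h \<in> tensor_fields2 M" and Y: "Y \<in> vector_fields M"
  shows "flat h Y \<in> one_forms M"
proof -
  have "fapply (flat h Y) X = tapply h Y X" for X
    by (simp add: fapply_def flat_def tapply_def)
  moreover have "flat h Y p \<in> cotangent_space M p" if "p \<in> points M" for p
    unfolding flat_def by (rule tensor2_cotangent(1)[OF h that vector_field_tangent[OF Y that]])
  moreover have "flat h Y p = 0" if "p \<notin> points M" for p
    using tensor2_off[OF h that] by (simp add: flat_def fun_eq_iff)
  ultimately show ?thesis
    using tensor2_smooth[OF h Y] by (simp add: one_forms_def)
qed

lemma flat_inj:
  assumes h: "h \<in> tensor_fields2 M" "nondegenerate M h"
    and "Y \<in> vector_fields M" "Z \<in> vector_fields M" "flat h Y = flat h Z"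
  shows "Y = Z"
proof
  fix p
  show "Y p = Z p"
  proof (cases "p \<in> points M")
    case True
    show ?thesis
      using fun_cong[OF assms(5), of p]
      by (intro inj_onD[OF tensor2_inj_on[OF h True] _ vector_field_tangent vector_field_tangent] assms True)
         (simp add: flat_def)
  next
    case False
    then show ?thesis using assms by (simp add: vector_field_off)
  qed
qed

end

section \<open>Connections and the dual connection\<close>

context smooth_mfd
begin

section \<open>Vector fields as derivations of the algebra of smooth functions\<close>

lemma vapply_off: "X \<in> vector_fields M \<Longrightarrow> p \<notin> points M \<Longrightarrow> vapply X f p = 0"
  by (simp add: vapply_def vector_field_off)

lemma vapply_add:
  assumes X: "X \<in> vector_fields M" and fg: "f \<in> smooth_functions M" "g \<in> smooth_functions M"
  shows "vapply X (f + g) = vapply X f + vapply X g"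
proof
  fix p
  show "vapply X (f + g) p = (vapply X f + vapply X g) p"
    using tangent_add[OF vector_field_tangent[OF X] fg] vapply_off[OF X]
    by (cases "p \<in> points M") (simp_all add: vapply_def)
qed

lemma vapply_cmult:
  assumes X: "X \<in> vector_fields M" and f: "f \<in> smooth_functions M"
  shows "vapply X (\<lambda>q. c * f q) = (\<lambda>q. c * vapply X f q)"
proof
  fix p
  show "vapply X (\<lambda>q. c * f q) p = c * vapply X f p"
    using tangent_cmult[OF vector_field_tangent[OF X] f] vapply_off[OF X]
    by (cases "p \<in> points M") (simp_all add: vapply_def)
qed

lemma vapply_mult:
  assumes X: "X \<in> vector_fields M" and fg: "f \<in> smooth_functions M" "g \<in> smooth_functions M"
  shows "vapply X (f * g) = f * vapply X g + g * vapply X f"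
proof
  fix p
  show "vapply X (f * g) p = (f * vapply X g + g * vapply X f) p"
    using tangent_mult[OF vector_field_tangent[OF X] fg] vapply_off[OF X]
    by (cases "p \<in> points M") (simp_all add: vapply_def)
qed

lemma vapply_not_smooth:
  assumes X: "X \<in> vector_fields M" and f: "f \<notin> smooth_functions M"
  shows "vapply X f = (\<lambda>_. 0)"
proof
  fix p
  show "vapply X f p = 0"
    using tangent_not_smooth[OF vector_field_tangent[OF X] f] vapply_off[OF X]
    by (cases "p \<in> points M") (simp_all add: vapply_def)
qed

text \<open>The mixed terms X(f) Y(g) and X(g) Y(f), which spoil the product rule for X Y alone,
  occur equally in Y X and cancel. For non-smooth f, both \<open>vapply X f\<close> and
  \<open>vapply Y f\<close> are the zero function, which every derivation annihilates.\<close>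

lemma lie_bracket_tangent:
  assumes X: "X \<in> vector_fields M" and Y: "Y \<in> vector_fields M" and p: "p \<in> points M"
  shows "lie_bracket X Y p \<in> tangent_space M p"
  unfolding tangent_space_def
proof (intro CollectI conjI ballI allI impI)
  note Xp = vector_field_tangent[OF X p] and Yp = vector_field_tangent[OF Y p]
  note sX = vector_field_smooth[OF X] and sY = vector_field_smooth[OF Y]
  fix f assume f: "f \<in> smooth_functions M"
  show "lie_bracket X Y p (f + g) = lie_bracket X Y p f + lie_bracket X Y p g"
    if g: "g \<in> smooth_functions M" for g
    using f g tangent_add[OF Xp sY[OF f] sY[OF g]] tangent_add[OF Yp sX[OF f] sX[OF g]]
    by (simp add: lie_bracket_def vapply_add[OF X] vapply_add[OF Y])
  show "lie_bracket X Y p (f * g) = f p * lie_bracket X Y p g + g p * lie_bracket X Y p f"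
    if g: "g \<in> smooth_functions M" for g
  proof -
    have "X p (vapply Y (f * g)) = X p (f * vapply Y g) + X p (g * vapply Y f)"
      unfolding vapply_mult[OF Y f g] by (intro tangent_add[OF Xp] smooth_functions_mult f g sY)
    moreover have "Y p (vapply X (f * g)) = Y p (f * vapply X g) + Y p (g * vapply X f)"
      unfolding vapply_mult[OF X f g] by (intro tangent_add[OF Yp] smooth_functions_mult f g sX)
    ultimately show ?thesis
      using tangent_mult[OF Xp f sY[OF g]] tangent_mult[OF Xp g sY[OF f]]
        tangent_mult[OF Yp f sX[OF g]] tangent_mult[OF Yp g sX[OF f]]
      by (simp add: lie_bracket_def vapply_def algebra_simps)
  qed
  show "lie_bracket X Y p (\<lambda>x. c * f x) = c * lie_bracket X Y p f" for c
    using tangent_cmult[OF Xp sY[OF f]] tangent_cmult[OF Yp sX[OF f]]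
    by (simp add: lie_bracket_def vapply_cmult[OF X f] vapply_cmult[OF Y f] right_diff_distrib)
next
  fix f assume "f \<notin> smooth_functions M"
  then show "lie_bracket X Y p f = 0"
    using tangent_const[OF vector_field_tangent[OF X p]] tangent_const[OF vector_field_tangent[OF Y p]]
    by (simp add: lie_bracket_def vapply_not_smooth[OF X] vapply_not_smooth[OF Y])
qed

lemma fapply_add:
  assumes \<alpha>: "\<alpha> \<in> one_forms M" and XY: "X \<in> vector_fields M" "Y \<in> vector_fields M"
  shows "fapply \<alpha> (X + Y) = fapply \<alpha> X + fapply \<alpha> Y"
proof
  fix p
  show "fapply \<alpha> (X + Y) p = (fapply \<alpha> X + fapply \<alpha> Y) p"
    using cotangent_add[OF one_form_cotangent[OF \<alpha>] XY[THEN vector_field_tangent]] one_form_off[OF \<alpha>]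
    by (cases "p \<in> points M") (simp_all add: fapply_def)
qed

lemma fapply_vscale:
  assumes \<alpha>: "\<alpha> \<in> one_forms M" and X: "X \<in> vector_fields M"
  shows "fapply \<alpha> (vscale f X) = f * fapply \<alpha> X"
proof
  fix p
  show "fapply \<alpha> (vscale f X) p = (f * fapply \<alpha> X) p"
    using cotangent_tscale[OF one_form_cotangent[OF \<alpha>] vector_field_tangent[OF X]] one_form_off[OF \<alpha>]
    by (cases "p \<in> points M") (simp_all add: fapply_def vscale_def)
qed

lemma one_forms_zero: "0 \<in> one_forms M"
  using smooth_functions_const[of 0] by (simp add: one_forms_def cotangent_space_def fapply_def)

lemma fapply_zero: "\<alpha> \<in> one_forms M \<Longrightarrow> fapply \<alpha> 0 = 0"
proof
  fix p assume \<alpha>: "\<alpha> \<in> one_forms M"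
  show "fapply \<alpha> 0 p = 0 p"
    using cotangent_zero[OF one_form_cotangent[OF \<alpha>]] one_form_off[OF \<alpha>]
    by (cases "p \<in> points M") (simp_all add: fapply_def)
qed

lemma affine_connection_vector_field:
  "affine_connection M D \<Longrightarrow> X \<in> vector_fields M \<Longrightarrow> Y \<in> vector_fields M \<Longrightarrow> D X Y \<in> vector_fields M"
  by (simp add: affine_connection_def)

text \<open>Replacing Y by f Y creates the extra term X(f) \<beta>(Y) twice, from the derivation X
  and from the Leibniz rule of the connection, with opposite signs.\<close>

lemma tensorial_cov_form:
  assumes D: "affine_connection M D" and X: "X \<in> vector_fields M" and \<beta>: "\<beta> \<in> one_forms M"
  shows "tensorial (\<lambda>Y. vapply X (fapply \<beta> Y) - fapply \<beta> (D X Y))"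
  unfolding tensorial_def
proof (intro conjI ballI allI impI)
  note DX = affine_connection_vector_field[OF D X]
  note sm = one_form_smooth[OF \<beta>]
  fix Y assume Y: "Y \<in> vector_fields M"
  let ?L = "\<lambda>Y. vapply X (fapply \<beta> Y) - fapply \<beta> (D X Y)"
  show "?L (Y + Z) = ?L Y + ?L Z" if Z: "Z \<in> vector_fields M" for Z
  proof -
    have "D X (Y + Z) = D X Y + D X Z"
      using D X Y Z by (simp add: affine_connection_def)
    then show ?thesis
      by (simp add: fapply_add[OF \<beta>] Y Z DX vapply_add[OF X sm sm])
  qed
  show "?L Y \<in> smooth_functions M"
    by (intro smooth_functions_diff vector_field_smooth X sm DX Y)
  show "?L Y p = 0" if "p \<notin> points M" for p
    using that by (simp add: vapply_off[OF X] fapply_def one_form_off[OF \<beta>])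
next
  fix f Y assume f: "f \<in> smooth_functions M" and Y: "Y \<in> vector_fields M"
  note DXY = affine_connection_vector_field[OF D X Y]
  have "D X (vscale f Y) = vscale f (D X Y) + vscale (vapply X f) Y"
    using D X Y f by (simp add: affine_connection_def)
  then have "fapply \<beta> (D X (vscale f Y)) = f * fapply \<beta> (D X Y) + vapply X f * fapply \<beta> Y"
    by (simp only: fapply_add[OF \<beta> vector_fields_vscale[OF f DXY] vector_fields_vscale[OF vector_field_smooth[OF X f] Y]]
        fapply_vscale[OF \<beta> DXY] fapply_vscale[OF \<beta> Y])
  moreover have "vapply X (fapply \<beta> (vscale f Y)) = f * vapply X (fapply \<beta> Y) + fapply \<beta> Y * vapply X f"
    unfolding fapply_vscale[OF \<beta> Y] by (rule vapply_mult[OF X f one_form_smooth[OF \<beta> Y]])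
  ultimately show "vapply X (fapply \<beta> (vscale f Y)) - fapply \<beta> (D X (vscale f Y)) =
      f * (vapply X (fapply \<beta> Y) - fapply \<beta> (D X Y))"
    by (simp add: fun_eq_iff algebra_simps)
qed

lemma
  assumes D: "affine_connection M D" and X: "X \<in> vector_fields M" and \<beta>: "\<beta> \<in> one_forms M"
  shows cov_form_one_form: "cov_form M D X \<beta> \<in> one_forms M"
    and fapply_cov_form:
      "Y \<in> vector_fields M \<Longrightarrow> fapply (cov_form M D X \<beta>) Y = vapply X (fapply \<beta> Y) - fapply \<beta> (D X Y)"
proof -
  let ?P = "\<lambda>\<gamma>. \<gamma> \<in> one_forms M \<and>
     (\<forall>Y\<in>vector_fields M. fapply \<gamma> Y = vapply X (fapply \<beta> Y) - fapply \<beta> (D X Y))"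
  obtain \<gamma> where \<gamma>: "?P \<gamma>"
    by (rule tensorial_one_form[OF tensorial_cov_form[OF assms]]) blast
  have "?P (cov_form M D X \<beta>)"
    unfolding cov_form_def
  proof (rule theI[of ?P, OF \<gamma>])
    fix \<gamma>' assume \<gamma>': "?P \<gamma>'"
    show "\<gamma>' = \<gamma>"
      by (rule one_form_ext) (use \<gamma> \<gamma>' in auto)
  qed
  then show "cov_form M D X \<beta> \<in> one_forms M"
    "Y \<in> vector_fields M \<Longrightarrow> fapply (cov_form M D X \<beta>) Y = vapply X (fapply \<beta> Y) - fapply \<beta> (D X Y)"
    by blast+
qed

lemma fapply_flat: "fapply (flat h X) Y = tapply h X Y"
  by (simp add: fapply_def flat_def tapply_def)

lemma tapply_signed_symmetric:
  assumes h: "h \<in> tensor_fields2 M"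
    and s: "\<forall>p\<in>points M. \<forall>v\<in>tangent_space M p. \<forall>w\<in>tangent_space M p. h p v w = s * h p w v"
    and XY: "X \<in> vector_fields M" "Y \<in> vector_fields M"
  shows "tapply h X Y = (\<lambda>p. s * tapply h Y X p)"
proof
  fix p
  show "tapply h X Y p = s * tapply h Y X p"
  proof (cases "p \<in> points M")
    case True
    have "X p \<in> tangent_space M p" "Y p \<in> tangent_space M p"
      using XY[THEN vector_field_tangent] True by blast+
    with s True show ?thesis unfolding tapply_def by blast
  qed (simp add: tapply_def tensor2_off[OF h])
qed

text \<open>Writing \<open>s\<close> for the sign with \<open>h(v, w) = s h(w, v)\<close>, the pairing \<open>hhat\<close> is
  \<open>- (\<alpha>(Y) + s \<beta>(X)) / 2\<close>. Testing the defining equation of the dual connection on pairs \<open>(W, 0)\<close>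
  and \<open>(0, flat h V)\<close> separates its two components.\<close>

lemma dual_gconnection_eq:
  assumes q: "quasi_statistical M h D" and sym: "symmetric_tensor M h \<or> skew_tensor M h"
    and X: "X \<in> vector_fields M" and Y: "Y \<in> vector_fields M" and \<beta>: "\<beta> \<in> one_forms M"
  shows "dual_gconnection M (hhat M h) (Dhat M h D) (X, \<alpha>) (Y, \<beta>) =
    (sharp M h (cov_form M D X (flat h Y)), cov_form M D X \<beta>)"
proof -
  have D: "affine_connection M D" and h: "h \<in> tensor_fields2 M" "nondegenerate M h"
    using q by (simp_all add: quasi_statistical_def)
  \<comment> \<open>The case split copies the one in \<open>hhat\<close>, which prefers the
    symmetric branch, so that the single formula \<open>hh\<close> covers both cases.\<close>
  define s :: real where "s = (if symmetric_tensor M h then 1 else - 1)"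
  have s: "\<forall>p\<in>points M. \<forall>v\<in>tangent_space M p. \<forall>w\<in>tangent_space M p. h p v w = s * h p w v"
  proof (cases "symmetric_tensor M h")
    case True
    then have "s = 1" by (simp only: s_def if_True)
    with True show ?thesis unfolding symmetric_tensor_def by (simp only: mult_1)
  next
    case False
    then have "s = - 1" by (simp only: s_def if_False)
    moreover have "skew_tensor M h" using False sym by blast
    ultimately show ?thesis unfolding skew_tensor_def by (simp only: mult_minus1)
  qed
  have ss: "s * s = 1" "s \<noteq> 0" by (simp_all add: s_def)
  have hh: "hhat M h (A, a) (B, b) = (\<lambda>p. - (1 / 2) * (fapply a B p + s * fapply b A p))" for A a B b
    by (simp add: hhat_def s_def fun_eq_iff)
  define Z where "Z = sharp M h (cov_form M D X (flat h Y))"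
  define \<gamma> where "\<gamma> = cov_form M D X \<beta>"
  note flatY = flat_one_form[OF h(1) Y]
  note covY = cov_form_one_form[OF D X flatY]
  have Z: "Z \<in> vector_fields M" and flatZ: "flat h Z = cov_form M D X (flat h Y)"
    unfolding Z_def by (rule sharp_vector_field[OF h covY], rule flat_sharp[OF h covY])
  have \<gamma>: "\<gamma> \<in> one_forms M"
    unfolding \<gamma>_def by (rule cov_form_one_form[OF D X \<beta>])
  let ?P = "\<lambda>\<mu>. \<mu> \<in> gsections M \<and> (\<forall>\<tau>\<in>gsections M. hhat M h \<tau> \<mu> =
     vapply (fst (X, \<alpha>)) (hhat M h \<tau> (Y, \<beta>)) - hhat M h (Dhat M h D (X, \<alpha>) \<tau>) (Y, \<beta>))"
  have P: "?P (Z, \<gamma>)"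
  proof (intro conjI ballI)
    show "(Z, \<gamma>) \<in> gsections M"
      using Z \<gamma> by (simp add: gsections_def)
    fix \<tau> assume "\<tau> \<in> gsections M"
    then obtain W \<omega> where \<tau>: "\<tau> = (W, \<omega>)" and W: "W \<in> vector_fields M" and \<omega>: "\<omega> \<in> one_forms M"
      by (auto simp: gsections_def)
    \<comment> \<open>Writing the test form as h(V, .) turns \<omega>(Z) into h(V, Z), which is s
      h(Z, V), the quantity that determines Z. It also makes V the field that \<open>Dhat\<close>
      differentiates when it acts on \<omega>.\<close>
    define V where "V = sharp M h \<omega>"
    have V: "V \<in> vector_fields M" and \<omega>V: "\<omega> = flat h V"
      unfolding V_def by (rule sharp_vector_field[OF h \<omega>], rule flat_sharp[OF h \<omega>, symmetric])
    note DXV = affine_connection_vector_field[OF D X V]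
    note swap = tapply_signed_symmetric[OF h(1) s]
    have "fapply \<omega> Z = (\<lambda>p. s * fapply (flat h Z) V p)"
      unfolding \<omega>V fapply_flat by (rule swap[OF V Z])
    then have 1: "fapply \<omega> Z = (\<lambda>p. s * (vapply X (tapply h Y V) p - tapply h Y (D X V) p))"
      unfolding flatZ fapply_cov_form[OF D X flatY V] fapply_flat by simp
    have 2: "fapply \<gamma> W = vapply X (fapply \<beta> W) - fapply \<beta> (D X W)"
      unfolding \<gamma>_def by (rule fapply_cov_form[OF D X \<beta> W])
    have 3: "fapply (flat h (D X V)) Y = (\<lambda>p. s * tapply h Y (D X V) p)"
      unfolding fapply_flat by (rule swap[OF DXV Y])
    have smooth: "tapply h Y V \<in> smooth_functions M" "fapply \<beta> W \<in> smooth_functions M"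
      by (intro tensor2_smooth[OF h(1) Y V] one_form_smooth[OF \<beta> W])+
    have "hhat M h \<tau> (Y, \<beta>) = (\<lambda>p. - (1 / 2) * s * (tapply h Y V + fapply \<beta> W) p)"
      unfolding \<tau> hh \<omega>V fapply_flat swap[OF V Y] by (simp add: fun_eq_iff algebra_simps)
    then have 4: "vapply X (hhat M h \<tau> (Y, \<beta>)) =
        (\<lambda>p. - (1 / 2) * s * (vapply X (tapply h Y V) p + vapply X (fapply \<beta> W) p))"
      using vapply_cmult[OF X smooth_functions_add[OF smooth], of "- (1 / 2) * s"]
      by (simp only: vapply_add[OF X smooth] plus_fun_apply)
    have 5: "hhat M h (Dhat M h D (X, \<alpha>) \<tau>) (Y, \<beta>) =
        (\<lambda>p. - (1 / 2) * (s * tapply h Y (D X V) p + s * fapply \<beta> (D X W) p))"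
      unfolding \<tau> Dhat_def split hh V_def[symmetric] 3 by (rule refl)
    show "hhat M h \<tau> (Z, \<gamma>) =
        vapply (fst (X, \<alpha>)) (hhat M h \<tau> (Y, \<beta>)) - hhat M h (Dhat M h D (X, \<alpha>) \<tau>) (Y, \<beta>)"
      unfolding fst_conv 4 5 unfolding \<tau> hh 1 2 by (simp add: fun_eq_iff algebra_simps)
  qed
  have "\<mu> = (Z, \<gamma>)" if \<mu>: "?P \<mu>" for \<mu>
  proof -
    obtain Z' \<gamma>' where \<mu>eq: "\<mu> = (Z', \<gamma>')" and Z': "Z' \<in> vector_fields M" and \<gamma>': "\<gamma>' \<in> one_forms M"
      using \<mu> by (auto simp: gsections_def)
    have eq: "hhat M h (W, \<omega>) (Z', \<gamma>') = hhat M h (W, \<omega>) (Z, \<gamma>)"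
      if "W \<in> vector_fields M" "\<omega> \<in> one_forms M" for W \<omega>
    proof -
      have "(W, \<omega>) \<in> gsections M" using that by (simp add: gsections_def)
      then show ?thesis
        using \<mu>[unfolded \<mu>eq, THEN conjunct2, rule_format, of "(W, \<omega>)"] P[THEN conjunct2, rule_format, of "(W, \<omega>)"]
        by simp
    qed
    have "\<gamma>' = \<gamma>"
    proof (rule one_form_ext[OF \<gamma>' \<gamma>])
      fix W assume W: "W \<in> vector_fields M"
      show "fapply \<gamma>' W = fapply \<gamma> W"
        using eq[OF W one_forms_zero] ss(2) by (simp add: hh fun_eq_iff fapply_def)
    qed
    moreover have "Z' = Z"
    proof (rule flat_inj[OF h Z' Z one_form_ext])
      fix V assume V: "V \<in> vector_fields M"
      note swap = tapply_signed_symmetric[OF h(1) s]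
      \<comment> \<open>This test puts Z' into the second slot of h, whereas \<open>flat\<close>
        uses the first; the sign symmetry exchanges the slots.\<close>
      have "tapply h V Z' = tapply h V Z"
        using eq[OF vector_fields_zero flat_one_form[OF h(1) V]]
        by (simp add: hh fapply_flat fapply_zero[OF \<gamma>] fapply_zero[OF \<gamma>'] fun_eq_iff)
      then show "fapply (flat h Z') V = fapply (flat h Z) V"
        unfolding fapply_flat swap[OF Z' V] swap[OF Z V] by simp
    qed (intro flat_one_form h Z Z')+
    ultimately show ?thesis by (simp add: \<mu>eq)
  qed
  with P show ?thesis
    unfolding dual_gconnection_def Z_def[symmetric] \<gamma>_def[symmetric] by (intro the_equality) blast+
qed

text \<open>By the definition of the covariant derivative of h, pairing the first term with W gives
  (\<nabla>_X h)(Y, W) + h(\<nabla>_X Y, W). After antisymmetrising in X and Y, the last summands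
  combine with - h([X, Y], W) to h(T(X, Y), W); in this way the torsion of the given connection is
  absorbed.\<close>

lemma dual_torsion_free:
  assumes q: "quasi_statistical M h D" and X: "X \<in> vector_fields M" and Y: "Y \<in> vector_fields M"
  shows "sharp M h (cov_form M D X (flat h Y)) - sharp M h (cov_form M D Y (flat h X)) - lie_bracket X Y = 0"
    (is "?Z1 - ?Z2 - _ = 0")
proof
  have D: "affine_connection M D" and h: "h \<in> tensor_fields2 M" "nondegenerate M h"
    using q by (simp_all add: quasi_statistical_def)
  note cov1 = cov_form_one_form[OF D X flat_one_form[OF h(1) Y]]
    and cov2 = cov_form_one_form[OF D Y flat_one_form[OF h(1) X]]
  note Z1 = sharp_vector_field[OF h cov1] and Z2 = sharp_vector_field[OF h cov2]
  have hZ1: "tapply h ?Z1 W = vapply X (tapply h Y W) - tapply h Y (D X W)" if "W \<in> vector_fields M" for W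
    using fapply_cov_form[OF D X flat_one_form[OF h(1) Y] that] flat_sharp[OF h cov1] by (metis fapply_flat)
  have hZ2: "tapply h ?Z2 W = vapply Y (tapply h X W) - tapply h X (D Y W)" if "W \<in> vector_fields M" for W
    using fapply_cov_form[OF D Y flat_one_form[OF h(1) X] that] flat_sharp[OF h cov2] by (metis fapply_flat)
  fix p
  show "(?Z1 - ?Z2 - lie_bracket X Y) p = 0 p"
  proof (cases "p \<in> points M")
    case False
    then show ?thesis
      using vector_field_off[OF Z1] vector_field_off[OF Z2] vector_field_off[OF X] vector_field_off[OF Y]
      by (simp add: lie_bracket_def fun_eq_iff)
  next
    case p: True
    note T1 = vector_field_tangent[OF Z1 p] and T2 = vector_field_tangent[OF Z2 p]
      and Tb = lie_bracket_tangent[OF X Y p]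
      and TX = vector_field_tangent[OF affine_connection_vector_field[OF D X Y] p]
      and TY = vector_field_tangent[OF affine_connection_vector_field[OF D Y X] p]
    have T: "?Z1 p - ?Z2 p - lie_bracket X Y p \<in> tangent_space M p"
      by (intro tangent_space_diff T1 T2 Tb)
    have "h p (?Z1 p - ?Z2 p - lie_bracket X Y p) w = 0" if w: "w \<in> tangent_space M p" for w
    proof -
      \<comment> \<open>Non-degeneracy is a statement about tangent vectors and the
        quasi-statistical identity one about fields; extending w to a field connects them. The terms
        that differentiate W are the same on both sides.\<close>
      obtain W where W: "W \<in> vector_fields M" "W p = w"
        using p w by (rule vector_field_extension)
      note cot = tensor2_cotangent(2)[OF h(1) p w]
      have "(cov_tensor D X h Y W - cov_tensor D Y h X W + tapply h (torsion D X Y) W) p = 0"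
        using q X Y W(1) by (simp add: quasi_statistical_def)
      moreover have "tapply h (torsion D X Y) W p = h p (D X Y p) w - h p (D Y X p) w - h p (lie_bracket X Y p) w"
        using cotangent_diff[OF cot tangent_space_diff[OF TX TY] Tb] cotangent_diff[OF cot TX TY]
        by (simp add: tapply_def torsion_def W(2))
      moreover have "h p (?Z1 p - ?Z2 p - lie_bracket X Y p) w = tapply h ?Z1 W p - tapply h ?Z2 W p - h p (lie_bracket X Y p) w"
        using cotangent_diff[OF cot tangent_space_diff[OF T1 T2] Tb] cotangent_diff[OF cot T1 T2]
        by (simp add: tapply_def W(2))
      ultimately show ?thesis
        unfolding hZ1[OF W(1)] hZ2[OF W(1)] by (simp add: cov_tensor_def tapply_def W(2))
    qed
    then have "?Z1 p - ?Z2 p - lie_bracket X Y p = 0"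
      using h(2) p T unfolding nondegenerate_def by blast
    then show ?thesis by simp
  qed
qed

end

theorem proposition3p5:
  fixes M :: "('a, 'e::euclidean_space) manifold"
    and h :: "'a tensor2" and D :: "'a connection"
  assumes "smooth_manifold M"
    and "quasi_statistical M h D"
    and "symmetric_tensor M h \<or> skew_tensor M h"
  shows "\<forall>\<sigma>\<in>gsections M. \<forall>\<tau>\<in>gsections M.
    gtorsion M D (dual_gconnection M (hhat M h) (Dhat M h D)) \<sigma> \<tau> = 0"
proof (intro ballI)
  interpret smooth_mfd M
    by standard (rule assms(1))
  fix \<sigma> \<tau> assume "\<sigma> \<in> gsections M" "\<tau> \<in> gsections M"
  then obtain X \<alpha> Y \<beta> where \<sigma>: "\<sigma> = (X, \<alpha>)" and \<tau>: "\<tau> = (Y, \<beta>)"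
    and X: "X \<in> vector_fields M" and \<alpha>: "\<alpha> \<in> one_forms M"
    and Y: "Y \<in> vector_fields M" and \<beta>: "\<beta> \<in> one_forms M"
    by (auto simp: gsections_def)
  show "gtorsion M D (dual_gconnection M (hhat M h) (Dhat M h D)) \<sigma> \<tau> = 0"
    unfolding gtorsion_def \<sigma> \<tau> gbracket_def split
      dual_gconnection_eq[OF assms(2,3) X Y \<beta>] dual_gconnection_eq[OF assms(2,3) Y X \<alpha>]
    by (simp add: dual_torsion_free[OF assms(2) X Y] zero_prod_def)
qed

end
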